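(* Let $\mathcal{C}$ be a distinct covering system with the least common multiple of its moduli of the form $L = 2^a 3^b 5^c$ with $a$, $b$, and $c$ positive integers such that $a \geq b \geq c$, and least modulus $m=5$. Then: (i) $b \geq 2$. (ii) If $a=3$, then $b \geq 3$ and $c \geq 2$. (iii) There exists a distinct covering system (with least modulus $m=5$ and $L=2^a3^b5^c$) with $a=3$, $b=3$, and $c=2$ not using moduli which are multiples of $675$. (iv) If $a=4$, then $c \geq 2$. (v) There exists a distinct covering system (with least modulus $m=5$ and $L=2^a3^b5^c$) with $a=4$, $b=2$, and $c=2$ not using moduli $25$, $100$, $300$, and $900$. (vi) There exists a distinct covering system (with least modulus $m=5$ and $L=2^a3^b5^c$) with $a=4$, $b=3$, and $c=1$ not using modulus $180$. (vii) There exists a distinct covering system (with least modulus $m=5$ and $L=2^a3^b5^c$) with $a=5$, $b=2$, and $c=1$.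
   Context: A covering system is a set of congruences $x \equiv r_i \pmod{n_i}$, $i=1,\ldots,k$, such that every integer satisfies at least one of the congruences. A distinct covering system is a covering system in which all moduli $n_i$ are distinct integers greater than $1$. The least modulus $m$ is the smallest of the $n_i$, and $L$ is the least common multiple of all the $n_i$.
   Formalization: Item (iv) is stated only for b=2 (if a=4 and b=2, then c≥2): as printed it contradicts (vi), whose system has a=4, b=3, c=1, and adding a congruence modulo 81 to that system refutes it for b=4 as well. *)

theory Defs
  imports "HOL-Number_Theory.Cong"
begin

(* A pair (r, n) stands for the congruence x = r (mod n). *)

type_synonym congruence = "int \<times> nat"

definition covering_system :: "congruence set \<Rightarrow> bool" where
  "covering_system C \<longleftrightarrow>
     finite C \<and> (\<forall>(r, n) \<in> C. n > 0) \<and>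
     (\<forall>x::int. \<exists>(r, n) \<in> C. [x = r] (mod int n))"

definition moduli :: "congruence set \<Rightarrow> nat set" where
  "moduli C = snd ` C"

(* Injectivity of snd also excludes two different representatives r, r'
   of the same residue class modulo the same n. *)

definition distinct_covering_system :: "congruence set \<Rightarrow> bool" where
  "distinct_covering_system C \<longleftrightarrow>
     covering_system C \<and> inj_on snd C \<and> (\<forall>n \<in> moduli C. n > 1)"

definition least_modulus :: "congruence set \<Rightarrow> nat" where
  "least_modulus C = Min (moduli C)"

definition modulus_lcm :: "congruence set \<Rightarrow> nat" where
  "modulus_lcm C = Lcm (moduli C)"

end

theory Submission
  imports Defs
begin

text \<open>
The negative parts exclude covering systems with distinct moduli \<open>n \<ge> 5\<close> that divide \<open>2 ^ a * 15\<close>,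
\<open>720\<close>, \<open>1080\<close> or \<open>1800\<close>; all excluded exponents reduce to these, since a system for a divisor of \<open>L\<close> is also
one for \<open>L\<close>.  The sum of the reciprocals of the admissible moduli exceeds \<open>1\<close> (in the first case for large \<open>a\<close>), so
counting alone is not enough: it has to be shown that the congruences overlap too much.

The idea is to count with weights.  By the Chinese remainder theorem a system is a family of boxes in a
product of three rings of prime power order (\<open>grid_cover_from_covering\<close>).  Fix the boxes of a few small moduli, and
choose a nonnegative weight that vanishes on them.  If the total weight is larger than the sum,
over the other moduli, of the weight of the heaviest box of each, then the boxes cannot cover
(\<open>refuted_if_too_heavy\<close>).

For \<open>2 ^ a * 15\<close> it is enough to fix the class modulo \<open>5\<close> and to give weight one to all points outside of it
(\<open>no_grid_cover_15\<close>); relative to the size of the grid the two sides agree in the limit, and for each finite \<open>a\<close> the total is larger.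
For \<open>720\<close>, \<open>1080\<close> and \<open>1800\<close> a case distinction on the boxes of several small moduli is needed, and each case
has its own weight.  The number of cases stays small because permuting sibling residue classes
in each of the three coordinates preserves covers, so that only one box of each orbit has to be
considered (\<open>refuted_split\<close>).  The case trees, with 46, 12 and 117 leaves, are listed explicitly and evaluated by
\<open>check\<close>, whose correctness is \<open>check_sound\<close>.

The positive parts are four explicit systems.  They are verified by splitting the integers into residue
classes until each class lies in one of the congruences (\<open>sweep_sound\<close>).
\<close>

section \<open>Coverings of a product of three prime-power rings\<close>

type_synonym triple = "int \<times> int \<times> int"
type_synonym grid = "int list \<times> int list \<times> int list"

text \<open>By the Chinese remainder theorem the integers modulo \<open>2 ^ a * 3 ^ b * 5 ^ c\<close> form a product of
three rings of prime power order.  A modulus is the triple of its prime powers, and one of its residue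
classes is a box, a product of three residue classes.  In this form all symmetries and all counting
arguments act on the three coordinates separately.\<close>

definition grid_moduli :: "grid \<Rightarrow> triple set" where
  "grid_moduli G = (case G of (Q2, Q3, Q5) \<Rightarrow>
     {(q2, q3, q5). q2 \<in> set Q2 \<and> q3 \<in> set Q3 \<and> q5 \<in> set Q5 \<and> 5 \<le> q2 * q3 * q5})"

fun reduced :: "triple \<Rightarrow> triple \<Rightarrow> bool" where
  "reduced (q2, q3, q5) (u, v, w) \<longleftrightarrow> u \<in> {0..<q2} \<and> v \<in> {0..<q3} \<and> w \<in> {0..<q5}"

fun in_box :: "triple \<Rightarrow> triple \<Rightarrow> triple \<Rightarrow> bool" where
  "in_box (q2, q3, q5) (u, v, w) (x, y, z) \<longleftrightarrow> x mod q2 = u \<and> y mod q3 = v \<and> z mod q5 = w"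

text \<open>Every modulus carries exactly one box.  Moduli that are missing in a covering system get an arbitrary
one, which can only help to cover.\<close>

definition grid_cover :: "grid \<Rightarrow> (triple \<Rightarrow> triple) \<Rightarrow> bool" where
  "grid_cover G res \<longleftrightarrow> (\<forall>m \<in> grid_moduli G. reduced m (res m)) \<and>
     (\<forall>p. \<exists>m \<in> grid_moduli G. in_box m (res m) p)"

definition powers :: "int \<Rightarrow> nat \<Rightarrow> int list" where
  "powers p e = map (\<lambda>k. p ^ k) [0..<Suc e]"

lemma set_powers: "set (powers p e) = {p ^ k | k. k \<le> e}"
  by (auto simp: powers_def image_def simp del: upt_Suc)

lemma divisor_of_three_prime_powers:
  fixes n a b c :: nat
  assumes "n dvd 2 ^ a * 3 ^ b * 5 ^ c"
  obtains i j k where "i \<le> a" "j \<le> b" "k \<le> c" "n = 2 ^ i * 3 ^ j * 5 ^ k"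
proof -
  obtain s w where n: "n = s * w" and s: "s dvd 2 ^ a * 3 ^ b" and w: "w dvd 5 ^ c"
    using division_decomp[OF assms] by blast
  obtain u v where s': "s = u * v" and u: "u dvd 2 ^ a" and v: "v dvd 3 ^ b"
    using division_decomp[OF s] by blast
  have "prime (2::nat)" "prime (3::nat)" "prime (5::nat)" by simp_all
  with u v w obtain i j k where "u = 2 ^ i" "i \<le> a" "v = 3 ^ j" "j \<le> b" "w = 5 ^ k" "k \<le> c"
    by (metis divides_primepow_nat)
  with n s' that show ?thesis by blast
qed

text \<open>The Chinese remainder theorem turns a point of the grid into an integer, and the congruence that this
integer satisfies yields a box around the point.\<close>

lemma grid_cover_from_covering:
  assumes dc: "distinct_covering_system C" and lm: "least_modulus C = 5"
    and lcm: "modulus_lcm C dvd 2 ^ a * 3 ^ b * 5 ^ c"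
  shows "\<exists>res. grid_cover (powers 2 a, powers 3 b, powers 5 c) res"
proof -
  let ?G = "(powers 2 a, powers 3 b, powers 5 c)"
  have fin: "finite C" and inj: "inj_on snd C"
    and cov: "\<And>x. \<exists>(r, n) \<in> C. [x = r] (mod int n)"
    using dc by (auto simp: distinct_covering_system_def covering_system_def)
  define rho where "rho n = fst (the_inv_into C snd n)" for n
  have rho: "rho n = r" if "(r, n) \<in> C" for r n
    using that the_inv_into_f_f[OF inj that] by (simp add: rho_def)
  define res where "res = (\<lambda>(q2, q3, q5). let r = rho (nat (q2 * q3 * q5)) in
                              (r mod q2, r mod q3, r mod q5))"
  have pos: "q > 0" if "q \<in> set (powers p e)" "p > 0" for p q e
    using that by (auto simp: set_powers)
  have "\<exists>m \<in> grid_moduli ?G. in_box m (res m) (x, y, z)" for x y z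
  proof -
    have "coprime (2::int) 3" "coprime (2::int) 5" "coprime (3::int) 5"
      by (simp_all add: coprime_iff_gcd_eq_1 gcd_non_0_int)
    then have "coprime (2 ^ a :: int) (3 ^ b)" "coprime (2 ^ a * 3 ^ b :: int) (5 ^ c)" by simp_all
    then obtain t t' where t: "[t = x] (mod 2 ^ a)" "[t = y] (mod 3 ^ b)"
      and t': "[t' = t] (mod 2 ^ a * 3 ^ b)" "[t' = z] (mod 5 ^ c)"
      by (meson binary_chinese_remainder_int)
    obtain r n where rn: "(r, n) \<in> C" and tr: "[t' = r] (mod int n)"
      using cov[of t'] by auto
    have nm: "n \<in> moduli C" using rn by (force simp: moduli_def)
    then have "n dvd modulus_lcm C" by (simp add: modulus_lcm_def)
    with lcm have "n dvd 2 ^ a * 3 ^ b * 5 ^ c" by (rule dvd_trans[rotated])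
    then obtain i j k where ijk: "i \<le> a" "j \<le> b" "k \<le> c" and n: "n = 2 ^ i * 3 ^ j * 5 ^ k"
      by (rule divisor_of_three_prime_powers)
    have "5 \<le> n"
      using nm lm fin by (metis Min_le finite_imageI least_modulus_def moduli_def)
    then have big: "5 \<le> (2::int) ^ i * 3 ^ j * 5 ^ k" using n zle_int[of 5 n] by simp
    have int_n: "int n = 2 ^ i * 3 ^ j * 5 ^ k" by (simp add: n)
    have "[t' = x] (mod 2 ^ i)"
    proof -
      have "[t' = x] (mod 2 ^ a)" using t t' by (meson cong_dvd_modulus cong_trans dvd_triv_left)
      then show ?thesis using ijk by (meson cong_dvd_modulus le_imp_power_dvd)
    qed
    moreover have "[t' = y] (mod 3 ^ j)"
    proof -
      have "[t' = y] (mod 3 ^ b)" using t t' by (meson cong_dvd_modulus cong_trans dvd_triv_right)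
      then show ?thesis using ijk by (meson cong_dvd_modulus le_imp_power_dvd)
    qed
    moreover have "[t' = z] (mod 5 ^ k)"
      using ijk t' by (meson cong_dvd_modulus le_imp_power_dvd)
    moreover have "[t' = r] (mod 2 ^ i)" "[t' = r] (mod 3 ^ j)" "[t' = r] (mod 5 ^ k)"
      using tr int_n by (auto elim!: cong_dvd_modulus)
    ultimately have "in_box (2 ^ i, 3 ^ j, 5 ^ k) (res (2 ^ i, 3 ^ j, 5 ^ k)) (x, y, z)"
      using rho[OF rn] n by (simp add: res_def Let_def cong_def nat_mult_distrib nat_power_eq)
    moreover have "(2 ^ i, 3 ^ j, 5 ^ k) \<in> grid_moduli ?G"
      using ijk big by (auto simp: grid_moduli_def set_powers)
    ultimately show ?thesis by blast
  qed
  moreover have "reduced m (res m)" if "m \<in> grid_moduli ?G" for m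
    using that pos by (auto simp: grid_moduli_def res_def Let_def)
  ultimately show ?thesis unfolding grid_cover_def by (metis prod_cases3)
qed

section \<open>Placing one more modulus, up to symmetry\<close>

text \<open>The search for a grid cover is a case distinction on the boxes of a few small moduli.  A
\<open>placement\<close> records the boxes that are fixed on the current branch.\<close>

type_synonym placement = "(triple \<times> triple) list"

definition refuted :: "grid \<Rightarrow> placement \<Rightarrow> bool" where
  "refuted G F \<longleftrightarrow> (fst ` set F \<subseteq> grid_moduli G \<longrightarrow>
     \<not> (\<exists>res. grid_cover G res \<and> (\<forall>(m, r) \<in> set F. res m = r)))"

text \<open>The residue classes modulo the powers of a prime form a tree.  Exchanging two sibling subtrees, here
the classes of \<open>u\<close> and \<open>v\<close> modulo \<open>Q\<close>, by a translation respects all congruences modulo these powers,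
so it carries grid covers to grid covers.  Such exchanges, one in each coordinate, are all the
symmetries that are needed.\<close>

definition swap :: "int \<Rightarrow> int \<Rightarrow> int \<Rightarrow> int \<Rightarrow> int" where
  "swap Q u v y = (if y mod Q = u mod Q then y + (v - u)
                   else if y mod Q = v mod Q then y - (v - u) else y)"

definition symmetry :: "int list \<Rightarrow> (int \<Rightarrow> int) \<Rightarrow> bool" where
  "symmetry Qs s \<longleftrightarrow> (\<forall>y. s (s y) = y) \<and>
     (\<forall>q \<in> set Qs. \<forall>y y'. y mod q = y' mod q \<longrightarrow> s y mod q = s y' mod q)"

text \<open>For \<open>t = v - u\<close> and \<open>Qs\<close> the powers of a prime \<open>p\<close>, this makes \<open>Q\<close> the least power of \<open>p\<close> that
does not divide \<open>t\<close>; then the classes of \<open>u\<close> and \<open>v\<close> modulo \<open>Q\<close> are siblings.  The condition is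
stated by divisibility alone so that it can be evaluated without knowing the prime.\<close>

definition swap_radius :: "int list \<Rightarrow> int \<Rightarrow> int \<Rightarrow> bool" where
  "swap_radius Qs t Q \<longleftrightarrow> \<not> Q dvd t \<and> list_all (\<lambda>q. q dvd t \<or> Q dvd q) Qs"

text \<open>Modulo a power that divides \<open>v - u\<close> the exchange moves nothing.  Modulo a multiple of \<open>Q\<close>, congruent
points lie in the same class modulo \<open>Q\<close>, so they are translated by the same amount.\<close>

lemma symmetry_swap:
  assumes "swap_radius Qs (v - u) Q"
  shows "symmetry Qs (swap Q u v)"
proof -
  have ne: "u mod Q \<noteq> v mod Q"
    using assms by (auto simp: swap_radius_def mod_eq_dvd_iff dvd_diff_commute)
  have shift: "(y + (v - u)) mod Q = v mod Q" if "y mod Q = u mod Q" for y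
  proof -
    have "(y + (v - u)) mod Q = (u + (v - u)) mod Q" using that by (rule mod_add_cong) simp
    then show ?thesis by simp
  qed
  have shift': "(y - (v - u)) mod Q = u mod Q" if "y mod Q = v mod Q" for y
  proof -
    have "(y - (v - u)) mod Q = (v - (v - u)) mod Q" using that by (rule mod_diff_cong) simp
    then show ?thesis by simp
  qed
  have "swap Q u v (swap Q u v y) = y" for y
    using ne shift[of y] shift'[of y] by (auto simp: swap_def)
  moreover have "swap Q u v y mod q = swap Q u v y' mod q"
    if q: "q \<in> set Qs" and eq: "y mod q = y' mod q" for q y y'
  proof -
    from assms q consider "q dvd v - u" | "Q dvd q"
      by (auto simp: swap_radius_def list_all_iff)
    then show ?thesis
    proof cases
      case 1
      then have "swap Q u v x mod q = x mod q" for x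
        using dvd_minus_iff[of q "v - u"] by (auto simp: swap_def mod_eq_dvd_iff)
      with eq show ?thesis by simp
    next
      case 2
      then have "y mod Q = y' mod Q" using eq by (metis mod_mod_cancel)
      then consider "y mod Q = u mod Q" "y' mod Q = u mod Q"
        | "y mod Q \<noteq> u mod Q" "y' mod Q \<noteq> u mod Q" "y mod Q = v mod Q" "y' mod Q = v mod Q"
        | "y mod Q \<noteq> u mod Q" "y' mod Q \<noteq> u mod Q" "y mod Q \<noteq> v mod Q" "y' mod Q \<noteq> v mod Q"
        by metis
      then show ?thesis
      proof cases
        case 1
        then show ?thesis using mod_add_cong[OF eq refl] by (simp only: swap_def if_True simp_thms)
      next
        case 2
        then show ?thesis using mod_diff_cong[OF eq refl] by (simp only: swap_def if_True if_False simp_thms)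
      next
        case 3
        show ?thesis unfolding swap_def 3[THEN if_not_P] by (rule eq)
      qed
    qed
  qed
  ultimately show ?thesis unfolding symmetry_def by blast
qed

fun fixed_by :: "int \<Rightarrow> int \<Rightarrow> int \<Rightarrow> (int \<times> int) list \<Rightarrow> bool" where
  "fixed_by Q u v [] \<longleftrightarrow> True"
| "fixed_by Q u v ((q, r) # cs) \<longleftrightarrow> swap Q u v r mod q = r \<and> fixed_by Q u v cs"

fun swappable :: "int list \<Rightarrow> (int \<times> int) list \<Rightarrow> int \<Rightarrow> int \<Rightarrow> int list \<Rightarrow> bool" where
  "swappable Qs cs u v [] \<longleftrightarrow> False"
| "swappable Qs cs u v (Q # Qs') \<longleftrightarrow>
     (if swap_radius Qs (v - u) Q then fixed_by Q u v cs else swappable Qs cs u v Qs')"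

text \<open>\<open>similar Qs cs u v\<close> says that the identity or one exchange takes \<open>u\<close> to \<open>v\<close> and preserves the
classes in \<open>cs\<close>, which are the projections of the boxes placed so far.\<close>

definition similar :: "int list \<Rightarrow> (int \<times> int) list \<Rightarrow> int \<Rightarrow> int \<Rightarrow> bool" where
  "similar Qs cs u v \<longleftrightarrow> (if u = v then True else swappable Qs cs u v Qs)"

definition canonical :: "int list \<Rightarrow> (int \<times> int) list \<Rightarrow> int \<Rightarrow> int" where
  "canonical Qs cs u = (case find (similar Qs cs u) [0..u] of Some v \<Rightarrow> v | None \<Rightarrow> u)"

definition representatives :: "int list \<Rightarrow> (int \<times> int) list \<Rightarrow> int \<Rightarrow> int list" where
  "representatives Qs cs q = remdups (map (canonical Qs cs) [0..q - 1])"

lemma fixed_by_iff: "fixed_by Q u v cs \<longleftrightarrow> (\<forall>(q, r) \<in> set cs. swap Q u v r mod q = r)"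
  by (induction cs) auto

lemma swappableD:
  "swappable Qs cs u v Qs' \<Longrightarrow> \<exists>Q. swap_radius Qs (v - u) Q \<and> fixed_by Q u v cs"
  by (induction Qs') (auto split: if_splits)

lemma similar_imp_symmetry:
  assumes "similar Qs cs u v" "\<forall>(q, r) \<in> set cs. r mod q = r"
  shows "\<exists>s. symmetry Qs s \<and> s u = v \<and> (\<forall>(q, r) \<in> set cs. s r mod q = r)"
proof (cases "u = v")
  case True
  then show ?thesis using assms(2) by (intro exI[of _ id]) (auto simp: symmetry_def)
next
  case False
  then obtain Q where "swap_radius Qs (v - u) Q" "fixed_by Q u v cs"
    using assms(1) swappableD unfolding similar_def by metis
  then show ?thesis using symmetry_swap
    by (intro exI[of _ "swap Q u v"]) (auto simp: fixed_by_iff swap_def)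
qed

lemma canonical:
  assumes "0 \<le> u"
  shows "similar Qs cs u (canonical Qs cs u)" "canonical Qs cs u \<in> {0..u}"
proof -
  obtain v where "find (similar Qs cs u) [0..u] = Some v"
    using assms by (metis atLeastAtMost_iff find_None_iff not_None_eq order_refl set_upto similar_def)
  moreover from this have "canonical Qs cs u = v" by (simp add: canonical_def)
  ultimately show "similar Qs cs u (canonical Qs cs u)" "canonical Qs cs u \<in> {0..u}"
    by (auto simp: find_Some_iff nth_upto)
qed

lemma representatives_range: "u \<in> set (representatives Qs cs q) \<Longrightarrow> u \<in> {0..<q}"
  by (force simp: representatives_def dest: canonical(2)[of _ Qs cs])

fun first_coord :: "(triple \<times> triple) \<Rightarrow> int \<times> int" where
  "first_coord ((q2, q3, q5), (u, v, w)) = (q2, u)"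
fun second_coord :: "(triple \<times> triple) \<Rightarrow> int \<times> int" where
  "second_coord ((q2, q3, q5), (u, v, w)) = (q3, v)"
fun third_coord :: "(triple \<times> triple) \<Rightarrow> int \<times> int" where
  "third_coord ((q2, q3, q5), (u, v, w)) = (q5, w)"

text \<open>The point \<open>x\<close> lies in the image of the class of \<open>u\<close>: an involution that respects congruences can be
moved from one side of a congruence to the other.\<close>

lemma symmetry_mod:
  assumes "symmetry Qs s" "q \<in> set Qs" "s x mod q = u" "u \<in> {0..<q}"
  shows "s u mod q = x mod q"
proof -
  have "u mod q = s x mod q" using assms(3,4) by auto
  then have "s u mod q = s (s x) mod q"
    using assms(1,2) unfolding symmetry_def by blast
  moreover have "s (s x) = x" using assms(1) unfolding symmetry_def by blast
  ultimately show ?thesis by simp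
qed

lemma grid_cover_symmetry:
  assumes gc: "grid_cover (Q2, Q3, Q5) res"
    and s: "symmetry Q2 s2" "symmetry Q3 s3" "symmetry Q5 s5"
  defines "res' \<equiv> \<lambda>(q2, q3, q5). case res (q2, q3, q5) of (u, v, w) \<Rightarrow>
             (s2 u mod q2, s3 v mod q3, s5 w mod q5)"
  shows "grid_cover (Q2, Q3, Q5) res'"
  unfolding grid_cover_def
proof (intro conjI ballI allI)
  fix m assume m: "m \<in> grid_moduli (Q2, Q3, Q5)"
  then have "reduced m (res m)" using gc by (auto simp: grid_cover_def)
  then show "reduced m (res' m)" by (cases m; cases "res m") (auto simp: res'_def)
next
  fix p :: triple
  obtain x y z where p: "p = (x, y, z)" by (metis prod_cases3)
  obtain m where m: "m \<in> grid_moduli (Q2, Q3, Q5)" and box: "in_box m (res m) (s2 x, s3 y, s5 z)"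
    using gc unfolding grid_cover_def by blast
  obtain q2 q3 q5 where mq: "m = (q2, q3, q5)" by (metis prod_cases3)
  obtain u v w where r: "res m = (u, v, w)" by (metis prod_cases3)
  have red: "reduced m (res m)" using gc m by (auto simp: grid_cover_def)
  have "s2 u mod q2 = x mod q2"
    using symmetry_mod[OF s(1), of q2 x] m box red r unfolding mq by (simp add: grid_moduli_def)
  moreover have "s3 v mod q3 = y mod q3"
    using symmetry_mod[OF s(2), of q3 y] m box red r unfolding mq by (simp add: grid_moduli_def)
  moreover have "s5 w mod q5 = z mod q5"
    using symmetry_mod[OF s(3), of q5 z] m box red r unfolding mq by (simp add: grid_moduli_def)
  ultimately have "in_box m (res' m) p" using r by (simp add: res'_def mq p)
  with m show "\<exists>m\<in>grid_moduli (Q2, Q3, Q5). in_box m (res' m) p" by blast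
qed

text \<open>A box inside a box that is already placed covers nothing new.\<close>

fun redundant :: "triple \<Rightarrow> triple \<Rightarrow> placement \<Rightarrow> bool" where
  "redundant m r [] \<longleftrightarrow> False"
| "redundant (q2, q3, q5) (u, v, w) (((d2, d3, d5), (x, y, z)) # F) \<longleftrightarrow>
     (if d2 dvd q2 \<and> d3 dvd q3 \<and> d5 dvd q5 \<and> u mod d2 = x \<and> v mod d3 = y \<and> w mod d5 = z
      then True else redundant (q2, q3, q5) (u, v, w) F)"

lemma redundantD:
  assumes "redundant m r F"
  shows "\<exists>(d, s) \<in> set F. \<forall>p. in_box m r p \<longrightarrow> in_box d s p"
  using assms
proof (induction m r F rule: redundant.induct)
  case (2 q2 q3 q5 u v w d2 d3 d5 x y z F)
  show ?case
  proof (cases "d2 dvd q2 \<and> d3 dvd q3 \<and> d5 dvd q5 \<and> u mod d2 = x \<and> v mod d3 = y \<and> w mod d5 = z")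
    case True
    have "in_box (d2, d3, d5) (x, y, z) p" if "in_box (q2, q3, q5) (u, v, w) p" for p
    proof -
      obtain a b c where p: "p = (a, b, c)" by (metis prod_cases3)
      have "a mod q2 mod d2 = a mod d2" "b mod q3 mod d3 = b mod d3" "c mod q5 mod d5 = c mod d5"
        using True by (simp_all add: mod_mod_cancel)
      with that True show ?thesis by (simp add: p)
    qed
    then have "\<forall>p. in_box (q2, q3, q5) (u, v, w) p \<longrightarrow> in_box (d2, d3, d5) (x, y, z) p" by blast
    then show ?thesis by (intro bexI[of _ "((d2, d3, d5), (x, y, z))"]) (simp_all only: prod.case list.set insertI1)
  next
    case False
    then have "redundant (q2, q3, q5) (u, v, w) F" using 2(2) by (simp only: redundant.simps if_False)
    from 2(1)[OF False this] obtain e where "e \<in> set F"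
      "case e of (d, s) \<Rightarrow> \<forall>p. in_box (q2, q3, q5) (u, v, w) p \<longrightarrow> in_box d s p" by blast
    then show ?thesis by (intro bexI[of _ e]) (simp_all only: list.set insert_iff simp_thms)
  qed
qed auto

text \<open>The functions below are evaluated by rewriting with their defining equations, which also rewrites
inside abstractions.  Partial applications of named functions do not unfold early, and they are
used here and later in place of abstractions.\<close>

definition irredundant :: "triple \<Rightarrow> placement \<Rightarrow> triple \<Rightarrow> bool" where
  "irredundant m F r \<longleftrightarrow> \<not> redundant m r F"

text \<open>The boxes of a new modulus that have to be tried: one representative of each orbit of the coordinatewise
symmetries that preserve the placed boxes, without the redundant ones.\<close>

fun choices :: "grid \<Rightarrow> placement \<Rightarrow> triple \<Rightarrow> triple list" where
  "choices (Q2, Q3, Q5) F (q2, q3, q5) = filter (irredundant (q2, q3, q5) F)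
     (List.product (representatives Q2 (map first_coord F) q2)
       (List.product (representatives Q3 (map second_coord F) q3)
                     (representatives Q5 (map third_coord F) q5)))"

definition extensions :: "placement \<Rightarrow> triple \<Rightarrow> triple list \<Rightarrow> placement list" where
  "extensions F m rs = map (\<lambda>r. (m, r) # F) rs"

text \<open>Let a grid cover extend the placement \<open>F\<close>.  Applying symmetries that preserve \<open>F\<close> makes the box of \<open>m\<close>
one of the representatives.  If it is redundant, then the remaining boxes already cover everything, and
the box of \<open>m\<close> may be moved to any of the irredundant choices; for this there must be at least one.\<close>

lemma refuted_split:
  assumes m: "m \<in> grid_moduli G" "m \<notin> fst ` set F"
    and ne: "choices G F m \<noteq> []"
    and sub: "\<And>r. r \<in> set (choices G F m) \<Longrightarrow> refuted G ((m, r) # F)"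
  shows "refuted G F"
  unfolding refuted_def
proof (intro impI notI)
  assume F: "fst ` set F \<subseteq> grid_moduli G"
  assume "\<exists>res. grid_cover G res \<and> (\<forall>(m, r)\<in>set F. res m = r)"
  then obtain res where gc: "grid_cover G res" and ag: "\<forall>(m, r)\<in>set F. res m = r" by blast
  have contra: False if "grid_cover G res'" "\<forall>(m, r)\<in>set F. res' m = r" "res' m \<in> set (choices G F m)" for res'
    using sub[OF that(3)] that(1,2) m(1) F by (auto simp: refuted_def)
  obtain Q2 Q3 Q5 where G: "G = (Q2, Q3, Q5)" by (metis prod_cases3)
  obtain q2 q3 q5 where mq: "m = (q2, q3, q5)" by (metis prod_cases3)
  obtain u v w where r: "res m = (u, v, w)" by (metis prod_cases3)
  have red: "u \<in> {0..<q2}" "v \<in> {0..<q3}" "w \<in> {0..<q5}"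
    using gc m(1) r by (auto simp: grid_cover_def mq)
  have redF: "reduced d s" if "(d, s) \<in> set F" for d s
  proof -
    have "res d = s" using that ag by auto
    moreover have "d \<in> grid_moduli G" using that F by (force simp: image_subset_iff)
    ultimately show ?thesis using gc by (auto simp: grid_cover_def)
  qed
  define u' where "u' = canonical Q2 (map first_coord F) u"
  define v' where "v' = canonical Q3 (map second_coord F) v"
  define w' where "w' = canonical Q5 (map third_coord F) w"
  have rng: "u' \<in> {0..<q2}" "v' \<in> {0..<q3}" "w' \<in> {0..<q5}"
    using canonical(2)[of u Q2 "map first_coord F"] canonical(2)[of v Q3 "map second_coord F"]
      canonical(2)[of w Q5 "map third_coord F"] red by (auto simp: u'_def v'_def w'_def)
  have coords: "snd (first_coord c) mod fst (first_coord c) = snd (first_coord c) \<and>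
      snd (second_coord c) mod fst (second_coord c) = snd (second_coord c) \<and>
      snd (third_coord c) mod fst (third_coord c) = snd (third_coord c)" if "c \<in> set F" for c
  proof -
    obtain d2 d3 d5 x y z where c: "c = ((d2, d3, d5), (x, y, z))" by (metis prod_cases3 surj_pair)
    then have "reduced (d2, d3, d5) (x, y, z)" using redF that by blast
    then have "x mod d2 = x" "y mod d3 = y" "z mod d5 = z" by (auto intro: mod_pos_pos_trivial)
    then show ?thesis by (simp only: c first_coord.simps second_coord.simps third_coord.simps fst_conv snd_conv)
  qed
  have F1: "\<forall>(q, r) \<in> set (map first_coord F). r mod q = r"
    and F2: "\<forall>(q, r) \<in> set (map second_coord F). r mod q = r"
    and F3: "\<forall>(q, r) \<in> set (map third_coord F). r mod q = r"
    using coords by (auto simp: split_beta)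
  obtain s2 where s2: "symmetry Q2 s2" "s2 u = u'" "\<forall>(q, r) \<in> set (map first_coord F). s2 r mod q = r"
    using similar_imp_symmetry[OF canonical(1) F1, of u Q2] red u'_def by auto
  obtain s3 where s3: "symmetry Q3 s3" "s3 v = v'" "\<forall>(q, r) \<in> set (map second_coord F). s3 r mod q = r"
    using similar_imp_symmetry[OF canonical(1) F2, of v Q3] red v'_def by auto
  obtain s5 where s5: "symmetry Q5 s5" "s5 w = w'" "\<forall>(q, r) \<in> set (map third_coord F). s5 r mod q = r"
    using similar_imp_symmetry[OF canonical(1) F3, of w Q5] red w'_def by auto
  define res' where "res' = (\<lambda>(q2, q3, q5). case res (q2, q3, q5) of (u, v, w) \<Rightarrow>
             (s2 u mod q2, s3 v mod q3, s5 w mod q5))"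
  have gc': "grid_cover G res'"
    using grid_cover_symmetry[of Q2 Q3 Q5 res s2 s3 s5] gc s2 s3 s5 by (simp add: G res'_def)
  have r': "res' m = (u', v', w')" using r rng s2 s3 s5 by (simp add: res'_def mq)
  have ag': "res' d = s" if ds: "(d, s) \<in> set F" for d s
  proof -
    obtain d2 d3 d5 where d: "d = (d2, d3, d5)" by (metis prod_cases3)
    obtain x y z where s: "s = (x, y, z)" by (metis prod_cases3)
    have "res d = s" using ag ds by auto
    moreover have "s2 x mod d2 = x" "s3 y mod d3 = y" "s5 z mod d5 = z"
      using s2(3) s3(3) s5(3) ds by (fastforce simp: d s)+
    ultimately show ?thesis by (simp add: res'_def d s)
  qed
  let ?P = "List.product (representatives Q2 (map first_coord F) q2)
       (List.product (representatives Q3 (map second_coord F) q3)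
                     (representatives Q5 (map third_coord F) q5))"
  have inP: "(u', v', w') \<in> set ?P"
    using red by (auto simp: representatives_def u'_def v'_def w'_def)
  show False
  proof (cases "redundant m (u', v', w') F")
    case False
    then have "(u', v', w') \<in> set (choices G F m)"
      using inP by (simp add: G mq irredundant_def)
    moreover have "\<forall>(d, s) \<in> set F. res' d = s" using ag' by blast
    ultimately show False using contra[OF gc'] r' by simp
  next
    case True
    then obtain d s where ds: "(d, s) \<in> set F" and sub_box: "\<forall>p. in_box m (u', v', w') p \<longrightarrow> in_box d s p"
      using redundantD by blast
    obtain r0 where r0: "r0 \<in> set (choices G F m)" using ne by (meson list.set_sel(1))
    let ?res = "res'(m := r0)"
    have "r0 \<in> set ?P" using r0 by (simp add: G mq)
    moreover obtain x y z where "r0 = (x, y, z)" by (metis prod_cases3)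
    ultimately have "reduced m r0" by (auto simp: mq dest: representatives_range)
    moreover have "\<exists>m' \<in> grid_moduli G. in_box m' (?res m') p" for p
    proof -
      obtain m' where m': "m' \<in> grid_moduli G" "in_box m' (res' m') p"
        using gc'[unfolded grid_cover_def, THEN conjunct2, rule_format, of p] by blast
      have "d \<in> fst ` set F" using ds by force
      then have "d \<noteq> m" "d \<in> grid_moduli G" using m(2) F by blast+
      moreover have "res' d = s" using ag'[OF ds] .
      ultimately have "?res d = s" "d \<in> grid_moduli G" by simp_all
      moreover have "?res m' = res' m'" if "m' \<noteq> m" using that by simp
      ultimately show ?thesis using m' sub_box r' by (cases "m' = m") (metis, metis)
    qed
    ultimately have "grid_cover G ?res" using gc' by (auto simp: grid_cover_def)
    moreover have "\<forall>(d, s) \<in> set F. ?res d = s"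
    proof (intro ballI, clarify)
      fix d s assume ds: "(d, s) \<in> set F"
      then have "d \<noteq> m" using m(2) by (metis fst_conv image_eqI)
      then show "?res d = s" using ag'[OF ds] by simp
    qed
    ultimately show False using contra[of ?res] r0 by simp
  qed
qed

section \<open>Refuting a placement by a weight\<close>

text \<open>A nonnegative weight on the points of the grid refutes a placement if it vanishes on the placed boxes
and if the heaviest boxes of all other moduli have less weight together than the whole grid.  This is the
dual linear program of fractional covering, and the weights used below are rounded solutions of it.

The placement looks the same from many points, so the weights are constant on large products of sets.
In \<open>(b2, b3, b5, W)\<close> the lists \<open>b2\<close>, \<open>b3\<close>, \<open>b5\<close> consist of blocks of residues of the three coordinates.
A point whose coordinates lie in the blocks with indices \<open>i\<close>, \<open>j\<close>, \<open>k\<close> has weight \<open>W ! k ! j ! i\<close>, and points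
outside all blocks have weight zero.\<close>

type_synonym weight = "int list list \<times> int list list \<times> int list list \<times> int list list list"

fun dot :: "int list \<Rightarrow> int list \<Rightarrow> int" where
  "dot (x # xs) (y # ys) = x * y + dot xs ys"
| "dot [] _ = 0"
| "dot _ [] = 0"

fun occurrences :: "int \<Rightarrow> int list \<Rightarrow> int" where
  "occurrences r [] = 0"
| "occurrences r (x # xs) = (if x = r then 1 + occurrences r xs else occurrences r xs)"

definition residues :: "int \<Rightarrow> int list \<Rightarrow> int list" where
  "residues q xs = map (\<lambda>x. x mod q) xs"

definition tally :: "int list list \<Rightarrow> int \<Rightarrow> int list" where
  "tally bs r = map (occurrences r) bs"

text \<open>How many elements of each block lie in a given residue class.  The mass of a box is a trilinear form in
the three profiles of its sides, with coefficients \<open>W\<close>.\<close>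

definition profile :: "int list list \<Rightarrow> int \<Rightarrow> int \<Rightarrow> int list" where
  "profile bs q r = tally (map (residues q) bs) r"

text \<open>By the symmetry of the blocks many residue classes modulo \<open>q\<close> have the same profile, so that few
distinct profiles remain.\<close>

definition profiles :: "int list list \<Rightarrow> int \<Rightarrow> int list list" where
  "profiles bs q = remdups (map (tally (map (residues q) bs)) [0..q - 1])"

definition contract1 :: "int list list \<Rightarrow> int list \<Rightarrow> int list" where
  "contract1 M v = map (dot v) M"

definition contract2 :: "int list list list \<Rightarrow> int list \<Rightarrow> int list list" where
  "contract2 W v = map (map (dot v)) W"

fun mass :: "weight \<Rightarrow> triple \<Rightarrow> triple \<Rightarrow> int" where
  "mass (b2, b3, b5, W) (q2, q3, q5) (u, v, w) =
     dot (profile b5 q5 w) (contract1 (contract2 W (profile b2 q2 u)) (profile b3 q3 v))"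

fun massless :: "weight \<Rightarrow> placement \<Rightarrow> bool" where
  "massless W [] \<longleftrightarrow> True"
| "massless W ((m, r) # F) \<longleftrightarrow> mass W m r = 0 \<and> massless W F"

text \<open>The default value \<open>0\<close> is harmless, because it only serves as an upper bound for masses.\<close>

fun max_list :: "int list \<Rightarrow> int" where
  "max_list [] = 0"
| "max_list (x # xs) = max x (max_list xs)"

definition max_dot :: "int list list \<Rightarrow> int list \<Rightarrow> int" where
  "max_dot vs w = max_list (map (dot w) vs)"

definition peak :: "int list list \<Rightarrow> int list list \<Rightarrow> int" where
  "peak vs ws = max_list (map (max_dot vs) ws)"

definition contract1_all :: "int list list \<Rightarrow> int list list \<Rightarrow> int list list" where
  "contract1_all vs M = map (contract1 M) vs"

fun usable :: "triple list \<Rightarrow> triple \<Rightarrow> bool" where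
  "usable ms (q2, q3, q5) \<longleftrightarrow> 5 \<le> q2 * q3 * q5 \<and> \<not> List.member ms (q2, q3, q5)"

text \<open>The sum over all usable moduli of the largest mass of a box.  The summation is nested by coordinates because
contracting \<open>W\<close> with the profiles of the first coordinate, and then of the second, is shared by all moduli
with these prime powers.\<close>

fun peaks5 :: "triple list \<Rightarrow> int \<Rightarrow> int \<Rightarrow> int list list \<Rightarrow> (int \<times> int list list) list \<Rightarrow> int" where
  "peaks5 ms q2 q3 vs [] = 0"
| "peaks5 ms q2 q3 vs ((q5, P) # ps) =
     (if usable ms (q2, q3, q5) then peak vs P else 0) + peaks5 ms q2 q3 vs ps"

fun peaks3 :: "triple list \<Rightarrow> int \<Rightarrow> (int \<times> int list list) list \<Rightarrow> int list list list \<Rightarrow>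
    (int \<times> int list list) list \<Rightarrow> int" where
  "peaks3 ms q2 P5 Ms [] = 0"
| "peaks3 ms q2 P5 Ms ((q3, P) # ps) =
     peaks5 ms q2 q3 (concat (map (contract1_all P) Ms)) P5 + peaks3 ms q2 P5 Ms ps"

fun peaks2 :: "triple list \<Rightarrow> (int \<times> int list list) list \<Rightarrow> (int \<times> int list list) list \<Rightarrow>
    int list list list \<Rightarrow> (int \<times> int list list) list \<Rightarrow> int" where
  "peaks2 ms P3 P5 W [] = 0"
| "peaks2 ms P3 P5 W ((q2, P) # ps) =
     peaks3 ms q2 P5 (map (contract2 W) P) P3 + peaks2 ms P3 P5 W ps"

definition with_profiles :: "int list list \<Rightarrow> int \<Rightarrow> int \<times> int list list" where
  "with_profiles bs q = (q, profiles bs q)"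

fun capacity :: "grid \<Rightarrow> triple list \<Rightarrow> weight \<Rightarrow> int" where
  "capacity (Q2, Q3, Q5) ms (b2, b3, b5, W) =
     peaks2 ms (map (with_profiles b3) Q3) (map (with_profiles b5) Q5) W (map (with_profiles b2) Q2)"

definition nonnegative :: "int \<Rightarrow> bool" where "nonnegative c \<longleftrightarrow> 0 \<le> c"

fun nonneg_weight :: "weight \<Rightarrow> bool" where
  "nonneg_weight (b2, b3, b5, W) \<longleftrightarrow> list_all nonnegative (concat (concat W))"

definition too_heavy :: "grid \<Rightarrow> placement \<Rightarrow> weight \<Rightarrow> bool" where
  "too_heavy G F W \<longleftrightarrow> nonneg_weight W \<and> massless W F \<and>
     capacity G (map fst F) W < mass W (1, 1, 1) (0, 0, 0)"

text \<open>The blocks, flattened to a list of residues in which each residue carries the coefficient of its block;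
this turns the trilinear form into a sum over weighted points.\<close>

definition points :: "int list list \<Rightarrow> 'a list \<Rightarrow> (int \<times> 'a) list" where
  "points bs cs = concat (map (\<lambda>(b, c). map (\<lambda>x. (x, c)) b) (zip bs cs))"

definition integral :: "weight \<Rightarrow> (triple \<Rightarrow> int) \<Rightarrow> int" where
  "integral = (\<lambda>(b2, b3, b5, W) f.
     (\<Sum>(z, M) \<leftarrow> points b5 W. \<Sum>(y, row) \<leftarrow> points b3 M. \<Sum>(x, c) \<leftarrow> points b2 row. c * f (x, y, z)))"

lemma occurrences_residues:
  "occurrences r (residues q xs) * c = (\<Sum>x\<leftarrow>xs. if x mod q = r then c else 0)"
  by (induction xs) (auto simp: residues_def algebra_simps)

lemma dot_profile:
  "dot (profile bs q r) (map f cs) = (\<Sum>(x, c) \<leftarrow> points bs cs. if x mod q = r then f c else 0)"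
proof (induction bs arbitrary: cs)
  case Nil
  then show ?case by (simp add: profile_def tally_def points_def)
next
  case (Cons b bs)
  show ?case
  proof (cases cs)
    case Nil
    then show ?thesis by (simp add: profile_def tally_def points_def)
  next
    case (Cons c cs')
    then show ?thesis using Cons.IH[of cs']
      by (simp add: profile_def tally_def points_def occurrences_residues comp_def)
  qed
qed

lemma sum_list_case_prod_0: "(\<Sum>(x, c) \<leftarrow> ps. 0) = (0 :: int)"
  by (induction ps) auto

lemma sum_list_case_prod_add:
  "(\<Sum>(x, c) \<leftarrow> ps. f x c + g x c) = (\<Sum>(x, c) \<leftarrow> ps. f x c) + (\<Sum>(x, c) \<leftarrow> ps. g x c :: int)"
  by (induction ps) auto

lemma mass_eq_integral:
  "mass W m r = integral W (\<lambda>p. of_bool (in_box m r p))"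
proof -
  obtain b2 b3 b5 T where W: "W = (b2, b3, b5, T)" by (metis prod_cases4)
  obtain q2 q3 q5 where m: "m = (q2, q3, q5)" by (metis prod_cases3)
  obtain u v w where r: "r = (u, v, w)" by (metis prod_cases3)
  note sum_list_case_prod_0 [simp]
  have inner: "dot (profile b2 q2 u) row = (\<Sum>(x, c) \<leftarrow> points b2 row. c * of_bool (x mod q2 = u))" for row
    using dot_profile[of b2 q2 u id row] by (simp add: of_bool_def if_distrib cong: if_cong)
  have "mass W m r = (\<Sum>(z, M) \<leftarrow> points b5 T. if z mod q5 = w then
      \<Sum>(y, row) \<leftarrow> points b3 M. if y mod q3 = v then
      \<Sum>(x, c) \<leftarrow> points b2 row. c * of_bool (x mod q2 = u) else 0 else 0)"
    by (simp add: W m r contract1_def contract2_def dot_profile comp_def inner cong: if_cong)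
  also have "\<dots> = integral W (\<lambda>p. of_bool (in_box m r p))"
    unfolding integral_def W m r prod.case
    by (intro arg_cong[of _ _ sum_list] map_cong refl) (auto intro!: arg_cong[of _ _ sum_list] map_cong)
  finally show ?thesis .
qed

lemma points_snd: "(x, c) \<in> set (points bs cs) \<Longrightarrow> c \<in> set cs"
  by (auto simp: points_def dest: set_zip_rightD)

lemma integral_mono:
  assumes "nonneg_weight W" "\<And>p. f p \<le> g p"
  shows "integral W f \<le> integral W g"
proof -
  obtain b2 b3 b5 T where W: "W = (b2, b3, b5, T)" by (metis prod_cases4)
  have "0 \<le> c" if "(z, M) \<in> set (points b5 T)" "(y, row) \<in> set (points b3 M)"
    "(x, c) \<in> set (points b2 row)" for z M y row x c
    using points_snd[OF that(1)] points_snd[OF that(2)] points_snd[OF that(3)] assms(1)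
    by (force simp: W list_all_iff nonnegative_def)
  then show ?thesis unfolding W integral_def prod.case
    by (intro sum_list_mono) (auto intro!: sum_list_mono mult_left_mono assms(2))
qed

lemma integral_sum_list:
  "integral W (\<lambda>p. \<Sum>i\<leftarrow>is. f i p) = (\<Sum>i\<leftarrow>is. integral W (f i))"
proof (induction "is")
  case Nil
  show ?case by (simp add: integral_def split_beta sum_list_case_prod_0)
next
  case (Cons i "is")
  have "integral W (\<lambda>p. f i p + g p) = integral W (f i) + integral W g" for g
    by (cases W) (simp add: integral_def distrib_left sum_list_case_prod_add)
  then show ?case using Cons by simp
qed

lemma max_list_ge: "x \<in> set xs \<Longrightarrow> x \<le> max_list xs"
  by (induction xs) auto

lemma max_list_nonneg: "0 \<le> max_list xs"
  by (induction xs) auto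

lemma peak_ge: "v \<in> set vs \<Longrightarrow> w \<in> set ws \<Longrightarrow> dot w v \<le> peak vs ws"
  unfolding peak_def max_dot_def by (rule order_trans[OF max_list_ge max_list_ge]) auto

lemma peaks5_eq: "peaks5 ms q2 q3 vs ps =
    (\<Sum>(q5, P) \<leftarrow> ps. if usable ms (q2, q3, q5) then peak vs P else 0)"
  by (induction ms q2 q3 vs ps rule: peaks5.induct) auto

lemma peaks3_eq: "peaks3 ms q2 P5 Ms ps =
    (\<Sum>(q3, P) \<leftarrow> ps. peaks5 ms q2 q3 (concat (map (contract1_all P) Ms)) P5)"
  by (induction ms q2 P5 Ms ps rule: peaks3.induct) auto

lemma peaks2_eq: "peaks2 ms P3 P5 W ps =
    (\<Sum>(q2, P) \<leftarrow> ps. peaks3 ms q2 P5 (map (contract2 W) P) P3)"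
  by (induction ms P3 P5 W ps rule: peaks2.induct) auto

lemma profile_in_profiles: "r \<in> {0..<q} \<Longrightarrow> profile bs q r \<in> set (profiles bs q)"
  by (auto simp: profile_def profiles_def)

lemma massless_iff: "massless W F \<longleftrightarrow> (\<forall>(m, r) \<in> set F. mass W m r = 0)"
  by (induction F) auto

lemma sum_list_product:
  "(\<Sum>p \<leftarrow> List.product xs ys. f p) = (\<Sum>x \<leftarrow> xs. \<Sum>y \<leftarrow> ys. f (x, y) :: int)"
  by (induction xs) (simp_all add: comp_def)

text \<open>In a grid cover the indicator functions of the boxes add up to at least one at every point.  Integrate
this inequality against the weight: a placed box contributes nothing, and every other box contributes at
most the peak of its modulus.\<close>

lemma refuted_if_too_heavy:
  assumes "too_heavy G F W"
  shows "refuted G F"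
  unfolding refuted_def
proof (intro impI notI)
  assume "\<exists>res. grid_cover G res \<and> (\<forall>(m, r)\<in>set F. res m = r)"
  then obtain res where gc: "grid_cover G res" and ag: "\<forall>(m, r)\<in>set F. res m = r" by blast
  obtain Q2 Q3 Q5 where G: "G = (Q2, Q3, Q5)" by (metis prod_cases3)
  obtain b2 b3 b5 T where W: "W = (b2, b3, b5, T)" by (metis prod_cases4)
  define ms where "ms = List.product Q2 (List.product Q3 Q5)"
  define ind where "ind m p = (if m \<in> grid_moduli G then of_bool (in_box m (res m) p) else (0::int))"
    for m p
  have nn: "nonneg_weight W" and ml: "massless W F"
    and lt: "capacity G (map fst F) W < mass W (1, 1, 1) (0, 0, 0)"
    using assms by (auto simp: too_heavy_def)
  have one: "1 \<le> (\<Sum>m\<leftarrow>ms. ind m p)" for p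
  proof -
    obtain m where m: "m \<in> grid_moduli G" "in_box m (res m) p"
      using gc unfolding grid_cover_def by blast
    then have "m \<in> set ms" by (auto simp: ms_def G grid_moduli_def)
    then have "ind m p \<le> (\<Sum>m\<leftarrow>ms. ind m p)"
      by (intro member_le_sum_list) (auto simp: ind_def)
    then show ?thesis using m by (simp add: ind_def)
  qed
  have bound: "integral W (ind (q2, q3, q5)) \<le>
      (if usable (map fst F) (q2, q3, q5) then
         peak (concat (map (contract1_all (profiles b3 q3)) (map (contract2 T) (profiles b2 q2)))) (profiles b5 q5)
       else 0)" if "(q2, q3, q5) \<in> set ms" for q2 q3 q5
  proof -
    let ?m = "(q2, q3, q5)"
    obtain u v w where r: "res ?m = (u, v, w)" by (metis prod_cases3)
    consider "?m \<notin> grid_moduli G" | "?m \<in> grid_moduli G" "?m \<in> fst ` set F"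
      | "?m \<in> grid_moduli G" "?m \<notin> fst ` set F" by blast
    then show ?thesis
    proof cases
      case 1
      then have "ind ?m = (\<lambda>p. 0)" by (simp add: ind_def fun_eq_iff)
      then have "integral W (ind ?m) = 0"
        using integral_sum_list[of W "\<lambda>_ _. 0" "[]"] by simp
      then show ?thesis by (simp add: peak_def max_list_nonneg)
    next
      case 2
      then obtain r' where r': "(?m, r') \<in> set F" by auto
      then have "res ?m = r'" "mass W ?m r' = 0" using ag ml by (auto simp: massless_iff)
      moreover have "ind ?m = (\<lambda>p. of_bool (in_box ?m (res ?m) p))"
        using 2 by (simp add: ind_def fun_eq_iff)
      ultimately have "integral W (ind ?m) = 0" by (simp only: mass_eq_integral)
      then show ?thesis by (simp add: peak_def max_list_nonneg)
    next
      case 3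
      then have red: "u \<in> {0..<q2}" "v \<in> {0..<q3}" "w \<in> {0..<q5}"
        using gc r by (auto simp: grid_cover_def)
      have us: "usable (map fst F) ?m"
        using 3 by (auto simp: G grid_moduli_def)
      have "integral W (ind ?m) = mass W ?m (u, v, w)"
        unfolding mass_eq_integral
        using 3 r by (intro arg_cong[of _ _ "integral W"]) (simp add: ind_def fun_eq_iff)
      also have "\<dots> = dot (profile b5 q5 w) (contract1 (contract2 T (profile b2 q2 u)) (profile b3 q3 v))"
        by (simp add: W)
      also have "\<dots> \<le> peak (concat (map (contract1_all (profiles b3 q3))
                  (map (contract2 T) (profiles b2 q2)))) (profiles b5 q5)"
        by (rule peak_ge)
          (use red[THEN profile_in_profiles] in \<open>auto simp: contract1_all_def\<close>)
      finally show ?thesis using us by simp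
    qed
  qed
  have "mass W (1, 1, 1) (0, 0, 0) = integral W (\<lambda>p. 1)"
    unfolding mass_eq_integral by (intro arg_cong[of _ _ "integral W"]) (simp add: fun_eq_iff)
  also have "\<dots> \<le> integral W (\<lambda>p. \<Sum>m\<leftarrow>ms. ind m p)"
    by (rule integral_mono[OF nn one])
  also have "\<dots> = (\<Sum>m\<leftarrow>ms. integral W (ind m))" by (rule integral_sum_list)
  also have "\<dots> \<le> (\<Sum>(q2, q3, q5)\<leftarrow>ms. if usable (map fst F) (q2, q3, q5) then
         peak (concat (map (contract1_all (profiles b3 q3)) (map (contract2 T) (profiles b2 q2)))) (profiles b5 q5)
       else 0)"
    by (rule sum_list_mono, clarify, rule bound)
  also have "\<dots> = capacity G (map fst F) W"
    by (simp add: ms_def G W peaks2_eq peaks3_eq peaks5_eq with_profiles_def sum_list_product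
        comp_def cong: if_cong)
  finally show False using lt by simp
qed

section \<open>Case trees\<close>

text \<open>A refutation is a case tree, written as the list of its nodes in preorder.  An inner node names the modulus
to be placed next, its children are the \<open>choices\<close> in their order, and a leaf carries a refuting
weight.  The second argument of \<open>check\<close> is the stack of placements that remain to be refuted; with an
explicit stack no recursion through lists of subtrees is needed.\<close>

datatype step = Split triple | Leaf weight

fun grid_modulus :: "grid \<Rightarrow> triple \<Rightarrow> bool" where
  "grid_modulus (Q2, Q3, Q5) (q2, q3, q5) \<longleftrightarrow>
     List.member Q2 q2 \<and> List.member Q3 q3 \<and> List.member Q5 q5 \<and> 5 \<le> q2 * q3 * q5"

fun check :: "grid \<Rightarrow> placement list \<Rightarrow> step list \<Rightarrow> bool" where
  "check G [] ss \<longleftrightarrow> True"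
| "check G (F # Fs) [] \<longleftrightarrow> False"
| "check G (F # Fs) (Leaf W # ss) \<longleftrightarrow> (if too_heavy G F W then check G Fs ss else False)"
| "check G (F # Fs) (Split m # ss) \<longleftrightarrow>
     (if grid_modulus G m \<and> \<not> List.member (map fst F) m \<and> choices G F m \<noteq> []
      then check G (extensions F m (choices G F m) @ Fs) ss else False)"

lemma check_sound: "check G Fs ss \<Longrightarrow> F \<in> set Fs \<Longrightarrow> refuted G F"
proof (induction G Fs ss arbitrary: F rule: check.induct)
  case (3 G F' Fs W ss)
  then show ?case using refuted_if_too_heavy[of G F' W] by (auto split: if_splits)
next
  case (4 G F' Fs m ss)
  then have ok: "grid_modulus G m" "m \<notin> fst ` set F'" "choices G F' m \<noteq> []"
    and IH: "\<And>F. F \<in> set (extensions F' m (choices G F' m) @ Fs) \<Longrightarrow> refuted G F"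
    by (auto split: if_splits)
  have "m \<in> grid_moduli G"
    using ok(1) by (cases G; cases m) (auto simp: grid_moduli_def)
  moreover have "refuted G ((m, r) # F')" if "r \<in> set (choices G F' m)" for r
    using that by (intro IH) (simp add: extensions_def)
  ultimately have "refuted G F'" using ok(2,3) refuted_split[of m G F'] by blast
  moreover have "F = F' \<or> F \<in> set Fs" using 4(3) by simp
  ultimately show ?case using IH[of F] unfolding set_append by blast
qed auto

lemma no_grid_cover:
  assumes "check G [[]] ss"
  shows "\<not> grid_cover G res"
proof -
  have "refuted G []" by (rule check_sound[OF assms]) simp
  then show ?thesis by (simp add: refuted_def)
qed

section \<open>No covering system with moduli dividing \<open>2 ^ a * 15\<close>\<close>

lemma card_residue_class_le:
  assumes "k \<le> a"
  shows "card {x \<in> {0..<2 ^ a}. x mod 2 ^ k = (u :: int)} \<le> 2 ^ (a - k)"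
proof -
  let ?A = "{x \<in> {0..<2 ^ a}. x mod 2 ^ k = u}"
  have "inj_on (\<lambda>x. x div 2 ^ k) ?A"
    by (rule inj_onI) (metis (mono_tags, lifting) div_mult_mod_eq mem_Collect_eq)
  moreover have "x div 2 ^ k \<in> {0..<2 ^ (a - k)}" if "x \<in> ?A" for x
  proof -
    have "(2::int) ^ a = 2 ^ (a - k) * 2 ^ k" using assms by (simp flip: power_add)
    then have "x < 2 ^ (a - k) * 2 ^ k" using that by simp
    moreover have "x div 2 ^ k * 2 ^ k \<le> x"
      using div_mult_mod_eq[of x "2 ^ k"] by (smt (verit) pos_mod_sign zero_less_power)
    ultimately have "x div 2 ^ k * 2 ^ k < 2 ^ (a - k) * 2 ^ k" by linarith
    then have "x div 2 ^ k < 2 ^ (a - k)" by (simp only: mult_less_cancel_right) auto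
    then show ?thesis using that by (simp add: pos_imp_zdiv_nonneg_iff)
  qed
  ultimately have "card ?A \<le> card {0..<(2::int) ^ (a - k)}"
    by (intro card_inj_on_le[of "\<lambda>x. x div 2 ^ k"]) auto
  then show ?thesis by (simp add: nat_power_eq)
qed

text \<open>Remove the residue class modulo \<open>5\<close> from the grid of size \<open>2 ^ a * 3 * 5\<close>, so that \<open>12 * 2 ^ a\<close> points
remain.  Then \<open>2 ^ (a - k) * slab_bound k\<close> bounds what the moduli \<open>2 ^ k\<close>, \<open>2 ^ k * 3\<close>, \<open>2 ^ k * 5\<close> and
\<open>2 ^ k * 15\<close> cover of them.  These moduli contribute \<open>12\<close>, \<open>4\<close>, \<open>3\<close> and \<open>1\<close>; the conditions on \<open>k\<close> leave out
the moduli below \<open>5\<close> and the modulus \<open>5\<close> itself.\<close>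

definition slab_bound :: "nat \<Rightarrow> nat" where
  "slab_bound k = (if k \<ge> 3 then 12 else 0) + (if k \<ge> 1 then 4 + 3 else 0) + 1"

text \<open>The bound is tight in the limit: the infinite series \<open>1 + 8/2 + 8/4 + 20/8 + 20/16 + ...\<close> has the
value \<open>12\<close>, so that every finite part of it is too small.\<close>

lemma sum_slab_bound_less: "(\<Sum>k\<le>a. 2 ^ (a - k) * slab_bound k) < 12 * 2 ^ a"
proof -
  have step: "(\<Sum>k\<le>Suc n. 2 ^ (Suc n - k) * slab_bound k) =
      2 * (\<Sum>k\<le>n. 2 ^ (n - k) * slab_bound k) + slab_bound (Suc n)" for n
    by (simp add: sum_distrib_left Suc_diff_le mult.assoc)
  have eq: "(\<Sum>k\<le>n + 2. 2 ^ (n + 2 - k) * slab_bound k) + 20 = 12 * 2 ^ (n + 2)" for n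
  proof (induction n)
    case 0
    show ?case by (simp add: numeral_2_eq_2 slab_bound_def)
  next
    case (Suc n)
    have "slab_bound (Suc (n + 2)) = 20" by (simp add: slab_bound_def)
    then show ?case using Suc step[of "n + 2"] by simp
  qed
  have ?thesis if "a = n + 2" for n
    using eq[of n] unfolding that by linarith
  moreover have "?thesis" if "a = 0 \<or> a = 1"
    using that by (auto simp: slab_bound_def)
  moreover have "a = a - 2 + 2 \<or> a = 0 \<or> a = 1" by auto
  ultimately show ?thesis by blast
qed

text \<open>The class modulo \<open>5\<close> leaves the proportion \<open>4/5\<close> of the grid.  For large \<open>a\<close> the reciprocals of the other
admissible moduli add up to almost \<open>11/12\<close>, which is more; but each modulus prime to \<open>5\<close> wastes a fifth of
its box on the class modulo \<open>5\<close>, and without this waste the sum drops below \<open>4/5\<close>.\<close>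

lemma no_grid_cover_15:
  assumes gc: "grid_cover (powers 2 a, [1, 3], [1, 5]) res"
  shows False
proof -
  let ?G = "(powers 2 a, [1, 3], [1, 5]) :: grid"
  obtain t where t: "snd (snd (res (1, 1, 5))) = t" by blast
  have in5: "(1, 1, 5) \<in> grid_moduli ?G"
    by (auto simp add: grid_moduli_def set_powers intro: exI[of _ 0])
  obtain u0 v0 where r5: "res (1, 1, 5) = (u0, v0, t)" by (metis prod.collapse t)
  have t_range: "t \<in> {0..<5}" using gc in5 r5 unfolding grid_cover_def by fastforce
  define P :: "triple set" where "P = {0..<2 ^ a} \<times> {0..<3} \<times> ({0..<5} - {t})"
  have finP: "finite P" by (simp add: P_def)
  define part where
    "part k q3 q5 = {p \<in> P. (2 ^ k, q3, q5) \<in> grid_moduli ?G \<and> in_box (2 ^ k, q3, q5) (res (2 ^ k, q3, q5)) p}"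
    for k and q3 q5 :: int
  define slab where "slab k = part k 1 1 \<union> part k 3 1 \<union> part k 1 5 \<union> part k 3 5" for k
  have part_le: "card (part k q3 q5) \<le> 2 ^ (a - k) * n3 * n5"
    if k: "k \<le> a" and n3: "\<And>v. card {y \<in> {0..<3}. y mod q3 = v} \<le> n3"
      and n5: "\<And>w. card {z \<in> {0..<5} - {t}. z mod q5 = w} \<le> n5" for k q3 q5 n3 n5
  proof -
    obtain u v w where r: "res (2 ^ k, q3, q5) = (u, v, w)" by (metis prod_cases3)
    let ?X = "{x \<in> {0..<2 ^ a}. x mod 2 ^ k = u}" and ?Y = "{y \<in> {0..<3}. y mod q3 = v}"
      and ?Z = "{z \<in> {0..<5} - {t}. z mod q5 = w}"
    have "part k q3 q5 \<subseteq> ?X \<times> ?Y \<times> ?Z" by (auto simp: part_def P_def r)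
    moreover have "finite ?X" "finite ?Y" "finite ?Z"
      by (auto intro: finite_subset[of _ "{0..<2 ^ a}"] finite_subset[of _ "{0..<3}"]
          finite_subset[of _ "{0..<5}"])
    then have "finite (?X \<times> ?Y \<times> ?Z)" by (intro finite_cartesian_product)
    ultimately have "card (part k q3 q5) \<le> card (?X \<times> ?Y \<times> ?Z)" by (meson card_mono)
    also have "\<dots> = card ?X * (card ?Y * card ?Z)" by (simp add: card_cartesian_product)
    also have "\<dots> \<le> 2 ^ (a - k) * (n3 * n5)"
      by (intro mult_le_mono card_residue_class_le k n3 n5)
    finally show ?thesis by (simp add: mult.assoc)
  qed
  have y1: "card {y \<in> {0..<3::int}. y mod 1 = v} \<le> 3" for v
    by (rule order_trans[OF card_mono[of "{0..<3}"]]) auto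
  have y3: "card {y \<in> {0..<3::int}. y mod 3 = v} \<le> 1" for v
    by (rule order_trans[OF card_mono[of "{v}"]]) auto
  have z1: "card {z \<in> {0..<5} - {t}. z mod 1 = w} \<le> 4" for w
    by (rule order_trans[OF card_mono[of "{0..<5} - {t}"]]) (use t_range in auto)
  have z5: "card {z \<in> {0..<5} - {t}. z mod 5 = w} \<le> 1" for w
    by (rule order_trans[OF card_mono[of "{w}"]]) auto
  have small: "part k 1 1 = {}" if "k < 3"
    for k
  proof -
    have "k = 0 \<or> k = 1 \<or> k = 2" using that by auto
    then show ?thesis by (auto simp: part_def grid_moduli_def)
  qed
  have small': "part 0 3 1 = {}" "part 0 1 5 = {}"
    using r5 by (auto simp: part_def grid_moduli_def P_def)
  have slab_le: "card (slab k) \<le> 2 ^ (a - k) * slab_bound k" if k: "k \<le> a" for k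
  proof -
    have "card (slab k) \<le> card (part k 1 1) + card (part k 3 1) + card (part k 1 5) + card (part k 3 5)"
      unfolding slab_def by (meson card_Un_le add_le_mono1 order_trans)
    moreover have "card (part k 1 1) \<le> 2 ^ (a - k) * (if k \<ge> 3 then 12 else 0)"
      using part_le[OF k y1 z1] small by auto
    moreover have "card (part k 3 1) \<le> 2 ^ (a - k) * (if k \<ge> 1 then 4 else 0)"
      using part_le[OF k y3 z1] small' by (cases k) auto
    moreover have "card (part k 1 5) \<le> 2 ^ (a - k) * (if k \<ge> 1 then 3 else 0)"
      using part_le[OF k y1 z5] small' by (cases k) auto
    moreover have "card (part k 3 5) \<le> 2 ^ (a - k) * 1"
      using part_le[OF k y3 z5] by simp
    ultimately have "card (slab k) \<le> 2 ^ (a - k) * ((if k \<ge> 3 then 12 else 0) +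
        (if k \<ge> 1 then 4 else 0) + (if k \<ge> 1 then 3 else 0) + 1)"
      unfolding distrib_left by linarith
    moreover have "(if k \<ge> 3 then 12 else 0) + (if k \<ge> 1 then 4 else 0) +
        (if k \<ge> 1 then 3 else 0) + 1 = slab_bound k"
      by (simp add: slab_bound_def)
    ultimately show ?thesis by (simp only:)
  qed
  have "P \<subseteq> (\<Union>k\<le>a. slab k)"
  proof
    fix p assume p: "p \<in> P"
    obtain m where m: "m \<in> grid_moduli ?G" "in_box m (res m) p"
      using gc unfolding grid_cover_def by blast
    then obtain k q3 q5 where "m = (2 ^ k, q3, q5)" "k \<le> a" "q3 = 1 \<or> q3 = 3" "q5 = 1 \<or> q5 = 5"
      by (auto simp: grid_moduli_def set_powers)
    with m p show "p \<in> (\<Union>k\<le>a. slab k)" by (auto simp: slab_def part_def)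
  qed
  then have "card P \<le> card (\<Union>k\<le>a. slab k)"
    by (intro card_mono) (auto simp: slab_def part_def finP)
  also have "\<dots> \<le> (\<Sum>k\<le>a. card (slab k))" by (rule card_UN_le) simp
  also have "\<dots> \<le> (\<Sum>k\<le>a. 2 ^ (a - k) * slab_bound k)" using slab_le by (intro sum_mono) auto
  also have "\<dots> < 12 * 2 ^ a" by (rule sum_slab_bound_less)
  also have "\<dots> = card P"
    using t_range by (simp add: P_def card_cartesian_product nat_power_eq)
  finally show False by simp
qed

section \<open>Case trees for \<open>720\<close>, \<open>1080\<close> and \<open>1800\<close>\<close>

text \<open>All three trees start by placing the modulus \<open>5\<close>, which has one choice up to symmetry.
The moduli to be placed are small ones, and a branch ends as soon as the placed boxes leave a part of the grid
that the other moduli cannot cover even fractionally.\<close>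

lemma check_1080: "check ([1,2,4,8], [1,3,9,27], [1,5]) [[]] [
   Split (1,1,5),
   Split (2,1,5),
   Split (8,1,1),
   Split (4,1,5),
   Leaf ([[1,3,5,7],[2,6],[4]],
       [[0,1,2,3,4,5,6,7,8,9,10,11,12,13,14,15,16,17,18,19,20,21,22,23,24,25,26]], [[1],[2],
       [3,4]], [[[4,0,0]],[[4,5,0]],[[3,5,5]]]),
   Split (4,3,1),
   Leaf ([[1,3,5,7],[2,6],[4]], [[0,3,6,9,12,15,18,21,24],
       [1,2,4,5,7,8,10,11,13,14,16,17,19,20,22,23,25,26]], [[1],[2],[3,4]], [[[1,0,0],[1,0,0]],
       [[1,0,0],[1,0,2]],[[1,2,0],[1,2,1]]]),
   Split (1,9,1),
   Leaf ([[1,3,5,7],[2,6],[4]], [[1,2,4,5,7,8,10,11,13,14,16,17,19,20,22,23,25,26],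
       [3,6,12,15,21,24]], [[1],[2],[3,4]], [[[1,0,0],[1,0,0]],[[1,0,2],[1,0,0]],[[1,2,1],
       [1,0,2]]]),
   Leaf ([[1,3,5,7],[2,6],[4]], [[0,3,6,9,12,15,18,21,24],[2,5,8,11,14,17,20,23,26],
       [4,7,13,16,22,25]], [[1],[2],[3,4]], [[[3,0,0],[3,0,0],[3,0,0]],[[3,0,4],[3,0,4],[3,0,4]],
       [[3,0,4],[3,3,4],[3,4,4]]]),
   Leaf ([[1,5],[2,6],[3,7],[4]], [[0,3,6,9,12,15,18,21,24],
       [1,2,4,5,7,8,10,11,13,14,16,17,19,20,22,23,25,26]], [[1],[2],[3,4]], [[[0,0,2,0],
       [1,0,2,0]],[[0,0,2,2],[2,0,1,2]],[[0,2,1,2],[1,2,0,2]]]),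
   Leaf ([[1,2,4,5,6],[3,7]],
       [[0,1,2,3,4,5,6,7,8,9,10,11,12,13,14,15,16,17,18,19,20,21,22,23,24,25,26]], [[1],[2,3,4]],
       [[[0,2]],[[2,1]]]),
   Leaf ([[1,5],[2,4,6],[3,7]],
       [[0,1,2,3,4,5,6,7,8,9,10,11,12,13,14,15,16,17,18,19,20,21,22,23,24,25,26]], [[1],[2],
       [3,4]], [[[2,0,1]],[[0,2,2]],[[2,2,1]]]),
   Split (4,1,5),
   Leaf ([[0,2,4,5,6],[3,7]],
       [[0,1,2,3,4,5,6,7,8,9,10,11,12,13,14,15,16,17,18,19,20,21,22,23,24,25,26]], [[1],[2,3,4]],
       [[[0,1]],[[1,1]]]),
   Leaf ([[0,2,4,6],[3,7],[5]],
       [[0,1,2,3,4,5,6,7,8,9,10,11,12,13,14,15,16,17,18,19,20,21,22,23,24,25,26]], [[1],[2],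
       [3,4]], [[[0,2,2]],[[2,2,0]],[[2,1,2]]]),
   Leaf ([[0,4],[2,6],[3,7],[5]],
       [[0,1,2,3,4,5,6,7,8,9,10,11,12,13,14,15,16,17,18,19,20,21,22,23,24,25,26]], [[1],[2],
       [3,4]], [[[0,0,2,2]],[[0,2,2,2]],[[2,2,1,2]]]),
   Leaf ([[0,2,3,4,6,7],[5]],
       [[0,1,2,3,4,5,6,7,8,9,10,11,12,13,14,15,16,17,18,19,20,21,22,23,24,25,26]], [[1],[2,3,4]],
       [[[0,1]],[[1,1]]]),
   Leaf ([[0,2,4,6],[3,7],[5]],
       [[0,1,2,3,4,5,6,7,8,9,10,11,12,13,14,15,16,17,18,19,20,21,22,23,24,25,26]], [[1],[2],
       [3,4]], [[[0,1,1]],[[1,0,1]],[[1,1,1]]])]"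
  by code_simp

lemma check_720: "check ([1,2,4,8,16], [1,3,9], [1,5]) [[]] [
   Split (1,1,5),
   Split (2,1,5),
   Split (1,9,1),
   Split (1,3,5),
   Split (8,1,1),
   Leaf ([[1,3,5,7,9,11,13,15],[2,4,6,10,12,14]], [[1,2,4,5,7,8],[3,6]], [[1],[2,3,4]], [[[3,0],
       [0,0]],[[3,4],[4,4]]]),
   Leaf ([[0,2,4,6,8,10,12,14],[3,5,7,11,13,15]], [[1,2,4,5,7,8],[3,6]], [[1],[2,3,4]], [[[0,1],
       [0,0]],[[1,1],[1,1]]]),
   Split (8,1,1),
   Split (16,1,1),
   Split (2,9,1),
   Leaf ([[1,3,5,7,9,11,13,15],[2,6,10,14],[12]], [[1,2,4,5,7,8],[3],[6]], [[1],[2],[3,4]],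
       [[[2,0,0],[3,0,0],[3,0,0]],[[2,3,3],[0,0,0],[0,0,0]],[[2,3,3],[3,0,0],[3,1,3]]]),
   Leaf ([[1,3,5,7,9,11,13,15],[2,6,10,14],[12]], [[1],[2,5,8],[3,6],[4,7]], [[1],[2],[3,4]],
       [[[0,0,0],[2,0,0],[3,0,0],[3,0,0]],[[3,0,0],[2,2,3],[0,0,0],[1,3,4]],[[3,0,0],[2,2,3],
       [3,3,4],[2,3,3]]]),
   Leaf ([[1,3,5,7,9,11,13,15],[2,6,10,14],[12]], [[1,2,4,5,7,8],[3],[6]], [[1],[2],[3,4]],
       [[[6,0,0],[0,0,0],[8,0,0]],[[6,8,8],[0,0,0],[0,0,0]],[[6,8,8],[0,8,12],[8,3,12]]]),
   Leaf ([[1,3,5,7,9,11,13,15],[2,6,10,14],[12]], [[1],[2,5,8],[3,6],[4,7]], [[1],[2],[3,4]],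
       [[[0,0,0],[1,0,0],[3,0,0],[3,0,0]],[[0,3,3],[2,2,2],[0,0,0],[3,2,2]],[[0,0,0],[2,2,2],
       [3,1,3],[2,3,3]]]),
   Leaf ([[1,3,5,7,9,11,13,15],[4,6,10,12,14]], [[1,2,4,5,7,8],[3,6]], [[1],[2],[3,4]], [[[2,0],
       [3,0]],[[2,3],[0,0]],[[2,3],[3,4]]]),
   Leaf ([[2,4,6,10,12,14],[3,7,11,15],[5,13],[9]], [[1,2,4,5,7,8],[3,6]], [[1],[2],[3,4]],
       [[[0,2,2,0],[0,2,2,2]],[[2,2,0,2],[0,0,0,0]],[[2,1,2,2],[2,2,2,2]]]),
   Split (2,3,1),
   Leaf ([[0,2,4,6,8,10,12,14],[3,5,7,11,13,15]], [[1,2,4,5,7,8],[3,6]], [[1],[2],[3,4]],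
       [[[0,1],[0,1]],[[1,1],[0,0]],[[1,1],[0,1]]]),
   Leaf ([[0,2,4,6,8,10,12,14],[3,7,11,15],[5,13]], [[1,4,7],[2,5,8],[3,6]], [[1],[2],[3,4]],
       [[[0,2,0],[0,0,2],[0,3,3]],[[0,2,2],[2,2,2],[0,0,0]],[[0,1,2],[2,2,1],[3,2,2]]]),
   Leaf ([[0,2,4,6,8,10,12,14],[3,5,7,11,13,15]], [[1,2,4,5,7,8],[3,6]], [[1],[2],[3,4]],
       [[[0,1],[0,0]],[[1,1],[0,0]],[[1,1],[1,0]]]),
   Leaf ([[0,2,4,6,8,10,12,14],[3,7,11,15],[5,13]], [[1,4,7],[2,5,8],[3,6]], [[1],[2],[3,4]],
       [[[0,0,0],[0,2,0],[0,3,3]],[[2,0,0],[2,2,2],[0,0,0]],[[2,0,0],[2,1,2],[2,3,3]]]),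
   Leaf ([[0,2,4,6,8,10,12,14],[1,3,5,7,9,11,13,15]], [[1,4,7],[2,5,8],[3,6]], [[1],[2,3,4]],
       [[[0,0],[0,15],[0,18]],[[15,15],[15,10],[18,12]]]),
   Split (2,3,5),
   Split (2,3,1),
   Leaf ([[0,2,4,6,8,10,12,14],[1,3,5,7,9,11,13,15]], [[1,4,7],[2,5,8],[3,6]], [[1],[2],[3,4]],
       [[[0,1],[0,0],[0,1]],[[0,0],[1,1],[0,1]],[[1,1],[1,1],[0,0]]]),
   Leaf ([[0,2,4,6,8,10,12,14],[1,3,5,7,9,11,13,15]], [[1,4,7],[2,5,8],[3,6]], [[1],[2],[3,4]],
       [[[0,1],[0,0],[0,1]],[[0,0],[1,1],[0,1]],[[0,1],[1,1],[1,0]]]),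
   Leaf ([[0,2,4,6,8,10,12,14],[1,3,5,7,9,11,13,15]], [[1,4,7],[2,5,8],[3,6]], [[1],[2],[3,4]],
       [[[0,2],[0,0],[0,2]],[[0,0],[0,0],[0,2]],[[2,1],[0,2],[2,0]]]),
   Leaf ([[0,2,4,6,8,10,12,14],[1,3,5,7,9,11,13,15]], [[1,4,7],[2,5,8],[3,6]], [[1],[2],[3,4]],
       [[[0,1],[0,1],[0,0]],[[0,0],[1,0],[0,0]],[[1,1],[1,1],[1,0]]]),
   Leaf ([[0,2,4,6,8,10,12,14],[1,3,5,7,9,11,13,15]], [[1,4,7],[2,5,8],[3,6]], [[1],[2],[3,4]],
       [[[0,0],[0,7],[0,7]],[[0,0],[7,6],[0,7]],[[7,0],[7,6],[7,6]]]),
   Split (8,1,1),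
   Leaf ([[1,3,5,7,9,11,13,15],[2,4,6,10,12,14]], [[1,4,7],[2,5,8],[3,6]], [[1],[2],[3,4]],
       [[[1,0],[0,0],[1,0]],[[0,0],[0,1],[1,0]],[[1,1],[0,1],[1,1]]]),
   Leaf ([[0,2,4,6,8,10,12,14],[3,7,11,15],[5,13]], [[1,4,7],[2,5,8],[3,6]], [[1],[2],[3,4]],
       [[[0,2,2],[0,0,0],[0,2,2]],[[0,0,0],[2,0,0],[0,1,2]],[[2,1,1],[1,0,0],[2,1,1]]]),
   Leaf ([[0,2,4,6,8,10,12,14],[1,3,5,7,9,11,13,15]], [[1,4,7],[2,5,8],[3,6]], [[1],[2],[3],[4]],
       [[[0,6],[0,0],[0,6]],[[0,0],[6,3],[6,0]],[[6,3],[5,3],[0,3]],[[6,3],[1,6],[6,3]]]),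
   Split (8,1,1),
   Leaf ([[1,3,5,7,9,11,13,15],[2,4,6,10,12,14]], [[1,4,7],[2,5,8],[3,6]], [[1],[2],[3],[4]],
       [[[12,0],[8,0],[13,0]],[[0,0],[11,17],[11,17]],[[13,0],[8,17],[11,17]],[[11,17],[9,2],
       [13,14]]]),
   Split (4,1,5),
   Leaf ([[0,2,4,6,8,10,12,14],[3,7,11,15],[5,13]], [[1,4,7],[2,5,8],[3,6]], [[1],[2],[3],[4]],
       [[[0,5,0],[0,0,0],[0,5,0]],[[0,0,0],[4,5,5],[5,3,7]],[[0,5,5],[4,0,1],[5,3,7]],[[5,0,5],
       [2,5,4],[5,5,2]]]),
   Leaf ([[0,2,4,6,8,10,12,14],[3,7,11,15],[5,13]], [[1,4,7],[2,5,8],[3,6]], [[1],[2],[3],[4]],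
       [[[0,2,2],[0,0,1],[0,2,2]],[[0,0,0],[2,2,0],[2,2,0]],[[0,2,2],[1,1,2],[2,1,2]],[[2,1,1],
       [1,2,2],[2,1,2]]]),
   Leaf ([[0,2,4,6,8,10,12,14],[3,7,11,15],[5,13]], [[1,4,7],[2,5,8],[3,6]], [[1],[2],[3],[4]],
       [[[0,2,2],[0,0,0],[0,2,3]],[[0,0,0],[1,2,2],[2,0,3]],[[0,2,0],[2,0,0],[2,2,0]],[[2,0,2],
       [1,2,2],[2,2,0]]]),
   Leaf ([[0,2,4,6,8,10,12,14],[3,7,11,15],[5,13]], [[1,4,7],[2,5,8],[3,6]], [[1],[2],[3],[4]],
       [[[0,2,2],[0,0,0],[0,2,3]],[[0,0,0],[1,2,2],[2,0,3]],[[0,2,2],[2,0,2],[2,2,0]],[[2,0,0],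
       [1,2,0],[2,2,0]]]),
   Leaf ([[0,4,8,12],[2,6,10,14],[3,5,7,11,13,15]], [[1,4,7],[2,5,8],[3,6]], [[1],[2],[3],[4]],
       [[[0,0,1],[0,0,0],[0,0,1]],[[0,0,0],[0,1,1],[0,1,1]],[[0,0,1],[1,1,0],[1,1,0]],[[1,1,0],
       [0,0,1],[1,1,1]]]),
   Leaf ([[0,4,8,12],[2,6,10,14],[3,7,11,15],[5,13]], [[1,4,7],[2,5,8],[3,6]], [[1],[2],[3],[4]],
       [[[0,0,2,1],[0,0,1,2],[0,0,2,2]],[[0,0,0,0],[2,2,1,1],[2,2,1,2]],[[0,0,2,2],[0,2,1,1],
       [0,2,2,2]],[[2,2,1,2],[1,1,2,2],[2,2,2,0]]]),
   Leaf ([[0,4,8,12],[2,6,10,14],[3,5,7,11,13,15]], [[1,4,7],[2,5,8],[3,6]], [[1],[2],[3],[4]],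
       [[[0,0,11],[0,0,6],[0,0,14]],[[0,0,0],[11,11,11],[14,14,7]],[[0,0,11],[11,11,10],
       [14,14,7]],[[0,11,11],[0,6,6],[0,14,14]]]),
   Leaf ([[0,2,4,6,8,10,12,14],[3,7,11,15],[5,13]], [[1,4,7],[2,5,8],[3,6]], [[1],[2],[3],[4]],
       [[[0,0,1],[0,0,2],[0,0,2]],[[0,0,0],[2,2,0],[2,2,1]],[[0,2,2],[1,1,0],[2,2,1]],[[2,2,1],
       [1,1,2],[2,2,1]]]),
   Leaf ([[0,2,4,6,8,10,12,14],[3,7,11,15],[5,13]], [[1,4,7],[2,5,8],[3,6]], [[1],[2],[3],[4]],
       [[[0,1,1],[0,1,0],[0,1,1]],[[0,0,0],[1,0,1],[1,0,1]],[[0,1,1],[0,1,1],[1,1,1]],[[1,1,1],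
       [1,1,1],[1,1,0]]]),
   Leaf ([[0,2,4,6,8,10,12,14],[3,7,11,15],[5,13]], [[1,4,7],[2,5,8],[3,6]], [[1],[2],[3],[4]],
       [[[0,2,2],[0,1,1],[0,2,2]],[[0,0,0],[2,2,0],[2,2,0]],[[0,0,2],[1,0,1],[2,0,2]],[[2,2,0],
       [1,1,2],[2,2,2]]]),
   Leaf ([[0,2,4,6,8,10,12,14],[3,7,11,15],[5,13]], [[1,4,7],[2,5,8],[3,6]], [[1],[2],[3],[4]],
       [[[0,2,0],[0,1,3],[0,3,3]],[[0,0,0],[2,3,0],[2,3,0]],[[0,3,2],[3,1,2],[2,2,2]],[[3,0,3],
       [0,0,0],[3,0,3]]]),
   Split (8,1,1),
   Split (16,1,1),
   Leaf ([[1,3,5,7,9,11,13,15],[2,6,10,14],[12]], [[1,4,7],[2,5,8],[3,6]], [[1],[2],[3,4]],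
       [[[4,0,0],[0,0,0],[4,0,0]],[[0,0,0],[4,0,0],[3,5,9]],[[4,4,6],[4,4,6],[4,5,3]]]),
   Leaf ([[1,3,5,7,9,11,13,15],[4,6,10,12,14]], [[1,4,7],[2,5,8],[3,6]], [[1],[2],[3,4]],
       [[[1,0],[0,0],[1,0]],[[0,0],[1,0],[1,2]],[[1,2],[1,2],[1,2]]]),
   Leaf ([[2,4,6,10,12,14],[3,7,11,15],[5,13],[9]], [[1,4,7],[2,5,8],[3,6]], [[1],[2],[3,4]],
       [[[0,4,2,4],[0,2,4,4],[0,3,4,4]],[[0,0,0,0],[0,0,0,4],[4,1,4,4]],[[4,2,3,2],[4,3,2,0],
       [4,3,2,2]]]),
   Leaf ([[0,2,4,6,8,10,12,14],[3,7,11,15],[5,13]], [[1,4,7],[2,5,8],[3,6]], [[1],[2],[3,4]],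
       [[[0,11,11],[0,10,10],[0,11,11]],[[0,0,0],[0,0,2],[11,8,11]],[[11,9,9],[11,10,8],
       [10,11,10]]]),
   Leaf ([[0,2,4,6,8,10,12,14],[1,3,5,7,9,11,13,15]], [[1,4,7],[2,5,8],[3,6]], [[1],[2],[3],[4]],
       [[[0,4],[0,0],[0,4]],[[0,0],[4,1],[4,1]],[[4,1],[0,4],[4,1]],[[3,2],[3,2],[1,4]]]),
   Leaf ([[0,2,4,6,8,10,12,14],[1,3,5,7,9,11,13,15]], [[1,4,7],[2,5,8],[3,6]], [[1],[2],[3,4]],
       [[[0,6],[0,5],[0,0]],[[0,0],[6,3],[6,3]],[[6,3],[3,2],[4,5]]]),
   Leaf ([[0,2,4,6,8,10,12,14],[1,3,5,7,9,11,13,15]], [[1,4,7],[2,5,8],[3,6]], [[1],[2],[3,4]],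
       [[[0,10],[0,3],[0,10]],[[0,0],[10,5],[10,0]],[[10,5],[5,6],[7,7]]]),
   Leaf ([[0,2,4,6,8,10,12,14],[1,3,5,7,9,11,13,15]], [[1,4,7],[2,5,8],[3,6]], [[1],[2],[3],[4]],
       [[[0,6],[0,2],[0,6]],[[0,0],[6,0],[6,3]],[[6,3],[2,5],[6,0]],[[6,3],[4,5],[3,6]]]),
   Leaf ([[0,2,4,6,8,10,12,14],[1,3,5,7,9,11,13,15]], [[1,4,7],[2,5,8],[3,6]], [[1],[2],[3,4]],
       [[[0,0],[0,2],[0,0]],[[0,0],[2,0],[2,2]],[[2,2],[1,1],[2,2]]]),
   Leaf ([[0,2,4,6,8,10,12,14],[1,3,5,7,9,11,13,15]], [[1,4,7],[2,5,8],[3,6]], [[1],[2],[3],[4]],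
       [[[0,2],[0,0],[0,2]],[[0,0],[2,2],[2,0]],[[2,0],[1,1],[2,2]],[[2,2],[1,1],[2,2]]]),
   Leaf ([[0,2,4,6,8,10,12,14],[1,3,5,7,9,11,13,15]], [[1,4,7],[2,5,8],[3,6]], [[1],[2],[3,4]],
       [[[0,4],[0,0],[0,4]],[[0,0],[4,0],[4,2]],[[4,2],[2,4],[3,2]]]),
   Leaf ([[0,2,4,6,8,10,12,14],[1,3,5,7,9,11,13,15]], [[1,4,7],[2,5,8],[3,6]], [[1],[2],[3,4]],
       [[[0,4],[0,0],[0,4]],[[0,0],[4,0],[4,2]],[[4,2],[2,4],[3,3]]]),
   Leaf ([[0,2,4,6,8,10,12,14],[1,3,5,7,9,11,13,15]], [[1,4,7],[2,5,8],[3,6]], [[1],[2],[3],[4]],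
       [[[0,4],[0,2],[0,4]],[[0,0],[4,2],[4,2]],[[4,2],[2,0],[4,2]],[[4,2],[2,4],[3,3]]])]"
  by code_simp

lemma check_1800: "check ([1,2,4,8], [1,3,9], [1,5,25]) [[]] [
   Split (1,1,5),
   Split (1,9,1),
   Split (1,1,25),
   Split (1,3,5),
   Split (2,1,5),
   Leaf ([[0,2,4,6],[1,3,5,7]], [[1,2,4,5,7,8],[3,6]], [[2,3,4,7,8,9,12,13,14,17,18,19,22,23,24],
       [6,11,16,21]], [[[4,3],[4,4]],[[0,4],[0,0]]]),
   Split (8,1,1),
   Split (2,3,1),
   Leaf ([[1,3,5,7],[2,4,6]], [[1,2,4,5,7,8],[3,6]], [[2,7,12,17,22],[3,4,8,9,13,14,18,19,23,24],
       [6,11,16,21]], [[[1,0],[1,0]],[[1,1],[1,0]],[[1,1],[0,0]]]),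
   Leaf ([[1,3,5,7],[2,4,6]], [[1,4,7],[2,5,8],[3,6]], [[2,7,12,17,22],
       [3,4,8,9,13,14,18,19,23,24],[6,11,16,21]], [[[0,0],[0,0],[1,0]],[[1,0],[1,1],[1,1]],
       [[1,0],[1,1],[0,0]]]),
   Leaf ([[1,3,5,7],[2,4,6]], [[1,2,4,5,7,8],[3,6]], [[2,7,12,17,22],[3,4,8,9,13,14,18,19,23,24],
       [6,11,16,21]], [[[1,0],[0,0]],[[1,1],[0,1]],[[1,1],[0,0]]]),
   Leaf ([[1,3,5,7],[2,4,6]], [[1,4,7],[2,5,8],[3,6]], [[2,7,12,17,22],
       [3,4,8,9,13,14,18,19,23,24],[6,11,16,21]], [[[0,0],[11,0],[14,0]],[[0,14],[11,14],
       [14,14]],[[0,17],[11,17],[0,0]]]),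
   Leaf ([[0,2,4,6],[3,5,7]], [[1,2,4,5,7,8],[3,6]], [[2,7,12,17,22],[3,4,8,9,13,14,18,19,23,24],
       [6,11,16,21]], [[[0,3],[0,4]],[[3,3],[4,4]],[[4,4],[0,0]]]),
   Split (2,1,5),
   Split (8,1,1),
   Leaf ([[1,3,5,7],[2,4,6]], [[1,2,4,5,7,8],[3,6]], [[2,7,12,17,22],[3,4,8,9,13,14,18,19,23,24],
       [6,11,16,21]], [[[12,15],[0,0]],[[12,15],[15,15]],[[11,0],[19,0]]]),
   Leaf ([[0,2,4,6],[3,7],[5]], [[1,2,4,5,7,8],[3,6]], [[2,7,12,17,22],
       [3,4,8,9,13,14,18,19,23,24],[6,11,16,21]], [[[4,4,4],[0,0,0]],[[4,4,4],[5,5,5]],[[0,4,5],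
       [0,6,6]]]),
   Split (8,1,1),
   Leaf ([[1,3,5,7],[2,4,6]], [[1,2,4,5,7,8],[3,6]], [[2,7,12,17,22],[3,4,8,9,13,14,18,19,23,24],
       [6,11,16,21]], [[[3,0],[0,0]],[[3,4],[4,4]],[[3,5],[5,5]]]),
   Leaf ([[0,2,4,6],[3,5,7]], [[1,2,4,5,7,8],[3,6]], [[2,7,12,17,22],
       [3,4,6,8,9,11,13,14,16,18,19,21,23,24]], [[[0,1],[0,0]],[[1,1],[1,1]]]),
   Split (8,1,1),
   Split (8,3,1),
   Leaf ([[1,3,5,7],[2,6],[4]], [[1,2,4,5,7,8],[3,6]], [[2,7,12,17,22],[3,8,13,18,23],
       [4,9,14,19,24],[6,11,16,21]], [[[2,3,3],[0,0,0]],[[2,0,0],[3,0,0]],[[2,3,3],[3,2,0]],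
       [[2,3,4],[3,3,0]]]),
   Leaf ([[1,3,5,7],[2,6],[4]], [[1,4,7],[2,5,8],[3,6]], [[2,7,12,17,22],[3,8,13,18,23],
       [4,9,14,19,24],[6,11,16,21]], [[[13,17,0],[13,17,18],[0,0,0]],[[12,0,0],[13,0,0],
       [17,0,0]],[[12,17,0],[13,17,18],[17,4,27]],[[14,18,0],[11,18,23],[17,14,34]]]),
   Leaf ([[1,3,5,7],[2],[4],[6]], [[1,2,4,5,7,8],[3,6]], [[2,7,12,17,22],[3,8,13,18,23],
       [4,9,14,19,24],[6,11,16,21]], [[[2,2,3,3],[0,0,0,0]],[[2,0,0,0],[3,0,0,0]],[[2,3,2,2],
       [3,0,3,2]],[[2,3,3,3],[3,0,4,4]]]),
   Leaf ([[1,3,5,7],[2],[4],[6]], [[1,4,7],[2,5,8],[3,6]], [[2,7,12,17,22],[3,8,13,18,23],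
       [4,9,14,19,24],[6,11,16,21]], [[[2,0,4,4],[2,0,4,4],[0,0,0,0]],[[2,0,0,0],[2,0,0,0],
       [2,0,0,0]],[[2,0,4,4],[2,1,4,3],[2,4,0,1]],[[2,0,4,4],[2,4,4,0],[3,2,2,4]]]),
   Leaf ([[1],[2,6],[3,7],[4],[5]], [[1,2,4,5,7,8],[3,6]], [[2,7,12,17,22],[3,8,13,18,23],
       [4,9,14,19,24],[6,11,16,21]], [[[0,3,3,4,4],[0,0,0,0,0]],[[2,0,2,0,4],[0,0,3,0,4]],
       [[4,3,3,4,0],[0,3,3,4,4]],[[0,4,1,5,5],[0,4,4,5,5]]]),
   Leaf ([[1],[2,6],[3,7],[4],[5]], [[1,4,7],[2,5,8],[3,6]], [[2,7,12,17,22],[3,8,13,18,23],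
       [4,9,14,19,24],[6,11,16,21]], [[[0,4,3,6,6],[2,4,2,6,6],[0,0,0,0,0]],[[0,0,4,0,6],
       [6,0,3,0,2],[6,0,4,0,2]],[[0,4,3,6,6],[1,4,3,6,5],[2,2,4,5,6]],[[0,4,1,7,7],[1,4,4,7,0],
       [1,4,4,6,7]]]),
   Split (1,9,5),
   Leaf ([[0,2,4,6],[3,5,7]], [[1,2,4,5,7,8],[3],[6]], [[2,7,12,17,22],[3,8,13,18,23],
       [4,9,14,19,24],[6,11,16,21]], [[[8,8],[0,0],[0,0]],[[0,8],[0,14],[0,10]],[[8,8],[12,14],
       [12,10]],[[10,10],[0,0],[15,15]]]),
   Leaf ([[0,2,4,6],[3,7],[5]], [[1,2,4,5,7,8],[3],[6]], [[2,7,12,17,22],[3,8,13,18,23],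
       [4,9,14,19,24],[6,11,16,21]], [[[3,3,3],[0,0,0],[0,0,0]],[[0,3,3],[0,0,0],[0,6,6]],
       [[3,3,3],[4,6,6],[4,3,3]],[[3,3,3],[5,7,7],[5,3,4]]]),
   Leaf ([[0,2,4,6],[3,5,7]], [[1,2,4,5,7,8],[3],[6]], [[2,7,12,17,22],[3,8,13,18,23],
       [4,9,14,19,24],[6,11,16,21]], [[[10,10],[0,0],[0,0]],[[0,8],[0,12],[0,12]],[[10,10],[0,0],
       [12,12]],[[10,10],[15,15],[15,15]]]),
   Leaf ([[0,2,4,6],[3,7],[5]], [[1],[2,5,8],[3,6],[4,7]], [[2,7,12,17,22],[3,8,13,18,23],
       [4,9,14,19,24],[6,11,16,21]], [[[4,4,3],[3,3,3],[0,0,0],[2,2,3]],[[0,4,4],[0,3,3],[0,4,4],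
       [0,2,2]],[[4,3,4],[3,3,3],[4,4,4],[2,3,2]],[[0,0,0],[3,3,3],[5,5,5],[5,5,5]]]),
   Leaf ([[0,2,4,6],[3,5,7]], [[1,3,6],[2,5,8],[4,7]], [[2,7,12,17,22],[3,8,13,18,23],
       [4,9,14,19,24],[6,11,16,21]], [[[0,0],[3,3],[5,5]],[[0,5],[0,3],[0,2]],[[5,5],[3,3],
       [2,2]],[[6,4],[4,4],[3,4]]]),
   Leaf ([[0,2,4,6],[3,5,7]], [[1],[2,5,8],[3,6],[4,7]], [[2,7,12,17,22],[3,8,13,18,23],
       [4,9,14,19,24],[6,11,16,21]], [[[2,4],[3,3],[0,0],[4,3]],[[0,0],[0,3],[0,4],[0,4]],[[4,4],
       [3,3],[4,4],[2,3]],[[4,5],[3,3],[5,5],[3,2]]]),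
   Leaf ([[0,2,4,6],[3,5,7]], [[1],[2,5,8],[3,6],[4,7]], [[2,7,12,17,22],[3,8,13,18,23],
       [4,9,14,19,24],[6,11,16,21]], [[[5,5],[3,3],[0,0],[2,2]],[[0,5],[0,3],[0,5],[0,2]],[[0,0],
       [3,3],[5,5],[5,5]],[[6,4],[4,4],[6,4],[3,4]]]),
   Split (2,1,5),
   Leaf ([[0,2,4,6],[1,3,5,7]], [[1,2,4,5,7,8],[3,6]], [[2,3,4,7,8,9,12,13,14,17,18,19,22,23,24],
       [6,11,16,21]], [[[3,3],[4,3]],[[0,0],[0,4]]]),
   Split (8,1,1),
   Split (4,3,1),
   Leaf ([[1,3,5,7],[2,6],[4]], [[1,4,7],[2,5,8],[3,6]], [[2,7,12,17,22],
       [3,4,8,9,13,14,18,19,23,24],[6,11,16,21]], [[[3,0,0],[2,0,0],[3,0,0]],[[3,2,4],[3,3,4],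
       [3,4,0]],[[0,0,0],[3,4,2],[3,5,0]]]),
   Leaf ([[1,3,5,7],[2,6],[4]], [[1,4,7],[2,5,8],[3,6]], [[2,7,12,17,22],
       [3,4,8,9,13,14,18,19,23,24],[6,11,16,21]], [[[2,0,0],[2,0,0],[2,0,0]],[[2,2,0],[2,2,2],
       [2,1,3]],[[0,0,0],[1,3,2],[2,3,3]]]),
   Leaf ([[1,3,5,7],[2,6],[4]], [[1,4,7],[2,5,8],[3,6]], [[2,7,12,17,22],
       [3,4,8,9,13,14,18,19,23,24],[6,11,16,21]], [[[3,0,0],[2,0,0],[3,0,0]],[[3,3,5],[2,3,0],
       [3,3,5]],[[0,0,0],[3,4,0],[4,5,5]]]),
   Leaf ([[1,3,5,7],[2,6],[4]], [[1,4,7],[2,5,8],[3,6]], [[2,7,12,17,22],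
       [3,4,8,9,13,14,18,19,23,24],[6,11,16,21]], [[[3,0,0],[2,0,0],[3,0,0]],[[3,4,4],[2,4,3],
       [3,0,4]],[[0,0,0],[3,4,5],[4,0,5]]]),
   Leaf ([[1,3,5,7],[2,6],[4]], [[1,4,7],[2,5,8],[3,6]], [[2,7,12,17,22],
       [3,4,8,9,13,14,18,19,23,24],[6,11,16,21]], [[[3,0,0],[2,0,0],[3,0,0]],[[3,0,4],[2,4,4],
       [3,4,4]],[[0,0,0],[3,4,4],[4,4,5]]]),
   Leaf ([[1,3,5,7],[2,6],[4]], [[1,4,7],[2,5,8],[3,6]], [[2,7,12,17,22],
       [3,4,8,9,13,14,18,19,23,24],[6,11,16,21]], [[[12,0,0],[8,0,0],[12,0,0]],[[12,16,16],
       [8,0,10],[12,16,16]],[[0,0,0],[15,0,20],[15,20,20]]]),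
   Leaf ([[1,5],[2,6],[3,7],[4]], [[1,4,7],[2,5,8],[3,6]], [[2,7,12,17,22],
       [3,4,8,9,13,14,18,19,23,24],[6,11,16,21]], [[[3,0,3,0],[3,0,2,0],[0,0,4,0]],[[3,3,3,3],
       [3,3,2,3],[0,4,4,5]],[[0,0,0,0],[1,4,4,4],[0,5,3,6]]]),
   Leaf ([[1,5],[2,4,6],[3,7]], [[1,4,7],[2,5,8],[3,6]], [[2,7,12,17,22],
       [3,4,8,9,13,14,18,19,23,24],[6,11,16,21]], [[[0,0,12],[6,0,12],[12,0,6]],[[0,12,12],
       [11,12,3],[9,12,9]],[[0,0,0],[10,15,0],[7,15,15]]]),
   Leaf ([[1,5],[2,4,6],[3,7]], [[1,4,7],[2,5,8],[3,6]], [[2,7,12,17,22],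
       [3,4,8,9,13,14,18,19,23,24],[6,11,16,21]], [[[6,0,3],[0,0,3],[6,0,3]],[[6,6,3],[0,6,6],
       [5,6,5]],[[0,0,0],[0,7,6],[4,8,8]]]),
   Split (2,1,25),
   Leaf ([[0,2,4,6],[3,7],[5]], [[1,4,7],[2,5,8],[3,6]], [[2,7,12,17,22],
       [3,4,8,9,13,14,18,19,23,24],[6],[11,16,21]], [[[0,38,39],[0,29,28],[0,38,39]],[[37,38,39],
       [31,30,28],[38,37,39]],[[0,0,0],[0,42,42],[0,63,63]],[[0,0,0],[42,27,42],[63,43,40]]]),
   Leaf ([[0,2,4,6],[3,7],[5]], [[1,4,7],[2,5,8],[3,6]], [[2,7,12,17,22],[3],[4,9,14,19,24],
       [6,11,16,21],[8,13,18,23]], [[[0,140,140],[0,97,97],[0,140,140]],[[0,175,175],[0,175,121],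
       [0,0,175]],[[140,140,140],[97,97,97],[140,140,140]],[[0,0,0],[152,162,162],[175,175,175]],
       [[175,131,131],[121,77,91],[175,175,131]]]),
   Leaf ([[0,2,4,6],[3,5,7]], [[1,4,7],[2,5,8],[3,6]], [[2,7,12,17,22],
       [3,4,8,9,13,14,18,19,23,24],[6],[11,16,21]], [[[0,4],[0,3],[0,4]],[[4,4],[3,3],[4,4]],
       [[0,0],[4,0],[5,0]],[[0,0],[4,5],[5,7]]]),
   Leaf ([[0,2,4,6],[3,5,7]], [[1,4,7],[2,5,8],[3,6]], [[3,4,8,9,13,14,18,19,23,24],[6,11,16,21],
       [7,12,17,22]], [[[10,10],[8,8],[10,10]],[[0,0],[8,12],[12,12]],[[0,12],[0,5],[0,12]]]),
   Leaf ([[0,2,4,6],[3,5,7]], [[1,4,7],[2,5,8],[3,6]], [[2,7,12,17,22],[3],[4,9,14,19,24],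
       [6,11,16,21],[8,13,18,23]], [[[0,12],[0,9],[0,12]],[[12,0],[0,0],[15,0]],[[12,12],[9,9],
       [12,12]],[[0,0],[12,15],[15,15]],[[12,15],[11,8],[11,15]]]),
   Split (2,1,5),
   Split (8,1,1),
   Split (4,3,1),
   Leaf ([[1,3,5,7],[2,6],[4]], [[1,4,7],[2,5,8],[3,6]], [[2,7,12,17,22],
       [3,4,8,9,13,14,18,19,23,24],[6,11,16,21]], [[[0,0,0],[3,3,2],[3,4,0]],[[3,2,4],[3,3,4],
       [3,4,0]],[[4,0,0],[1,0,0],[4,0,0]]]),
   Leaf ([[1,3,5,7],[2,6],[4]], [[1,4,7],[2,5,8],[3,6]], [[2,7,12,17,22],
       [3,4,8,9,13,14,18,19,23,24],[6,11,16,21]], [[[0,0,0],[3,3,3],[2,4,5]],[[3,3,0],[3,3,3],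
       [3,2,5]],[[4,0,0],[1,0,0],[4,0,0]]]),
   Leaf ([[1,3,5,7],[2,6],[4]], [[1,4,7],[2,5,8],[3,6]], [[2,7,12,17,22],
       [3,4,8,9,13,14,18,19,23,24],[6,11,16,21]], [[[0,0,0],[1,1,0],[1,1,1]],[[1,1,1],[1,1,0],
       [1,1,1]],[[1,0,0],[0,0,0],[1,0,0]]]),
   Leaf ([[1,3,5,7],[2,6],[4]], [[1,4,7],[2,5,8],[3,6]], [[2,7,12,17,22],
       [3,4,8,9,13,14,18,19,23,24],[6,11,16,21]], [[[0,0,0],[2,3,3],[2,0,4]],[[2,3,3],[2,3,3],
       [2,0,2]],[[3,0,0],[1,0,0],[3,0,0]]]),
   Leaf ([[1,3,5,7],[2,6],[4]], [[1,4,7],[2,5,8],[3,6]], [[2,7,12,17,22],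
       [3,4,8,9,13,14,18,19,23,24],[6,11,16,21]], [[[0,0,0],[2,3,3],[2,3,3]],[[2,0,3],[2,3,3],
       [2,3,3]],[[3,0,0],[1,0,0],[3,0,0]]]),
   Split (2,1,25),
   Leaf ([[1,3,5,7],[2,6],[4]], [[1,4,7],[2,5,8],[3,6]], [[2],[3,4,8,9,13,14,18,19,23,24],
       [6,11,16,21],[7,12,17,22]], [[[0,0,0],[4,0,0],[4,0,0]],[[3,4,4],[2,0,3],[3,4,4]],[[4,0,0],
       [2,0,0],[4,0,0]],[[0,0,0],[3,0,5],[3,5,5]]]),
   Leaf ([[1,3,5,7],[2,6],[4]], [[1,4,7],[2,5,8],[3,6]], [[2,7,12,17,22],[3],[4,9,14,19,24],
       [6,11,16,21],[8,13,18,23]], [[[0,0,0],[4,0,5],[4,5,5]],[[5,0,0],[0,0,0],[5,0,0]],[[4,5,5],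
       [2,0,3],[4,5,5]],[[4,0,0],[3,0,0],[4,0,0]],[[3,6,6],[3,0,4],[3,6,6]]]),
   Leaf ([[1,3,5,7],[2,6],[4]], [[1,4,7],[2,5,8],[3,6]], [[2,7,12,17,22],
       [3,4,8,9,13,14,18,19,23,24],[11,16,21]], [[[0,0,0],[3,0,4],[3,4,4]],[[3,4,4],[2,0,2],
       [3,4,4]],[[4,0,0],[3,0,0],[4,0,0]]]),
   Leaf ([[1,3,5,7],[2,6],[4]], [[1,4,7],[2,5,8],[3,6]], [[2],[3,4,8,9,13,14,18,19,23,24],
       [6,11,16,21],[7,12,17,22]], [[[0,0,0],[0,0,4],[0,4,4]],[[3,4,4],[2,0,2],[3,4,4]],[[4,0,0],
       [2,0,0],[4,0,0]],[[0,0,0],[4,0,4],[4,4,4]]]),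
   Leaf ([[1,3,5,7],[2,6],[4]], [[1,4,7],[2,5,8],[3,6]], [[2,7,12,17,22],[3],[4,9,14,19,24],
       [6,11,16,21],[8,13,18,23]], [[[0,0,0],[4,0,5],[4,5,5]],[[0,5,5],[0,0,3],[0,5,5]],[[4,5,5],
       [2,0,3],[4,5,5]],[[5,0,0],[3,0,0],[5,0,0]],[[5,5,5],[3,0,3],[5,5,5]]]),
   Leaf ([[1,5],[2,4,6],[3,7]], [[1,4,7],[2,5,8],[3,6]], [[2,7,12,17,22],
       [3,4,8,9,13,14,18,19,23,24],[6,11,16,21]], [[[0,0,0],[3,3,3],[0,4,4]],[[3,3,3],[3,3,2],
       [0,4,3]],[[4,0,4],[1,0,2],[0,0,4]]]),
   Leaf ([[1,5],[2,4,6],[3,7]], [[1,4,7],[2,5,8],[3,6]], [[2,7,12,17,22],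
       [3,4,8,9,13,14,18,19,23,24],[6,11,16,21]], [[[0,0,0],[0,4,4],[4,4,2]],[[0,4,4],[4,4,1],
       [3,4,3]],[[0,0,5],[5,0,1],[2,0,5]]]),
   Leaf ([[1,5],[2,4,6],[3,7]], [[1,4,7],[2,5,8],[3,6]], [[2,7,12,17,22],
       [3,4,8,9,13,14,18,19,23,24],[6,11,16,21]], [[[0,0,0],[0,4,2],[4,4,2]],[[4,4,2],[0,4,4],
       [3,4,3]],[[4,0,3],[0,0,3],[3,0,4]]]),
   Split (4,1,5),
   Leaf ([[0,2,4,6],[3,7],[5]], [[1,4,7],[2,5,8],[3,6]], [[2,7,12,17,22],
       [3,4,8,9,13,14,18,19,23,24],[6,11,16,21]], [[[0,0,0],[3,3,3],[3,3,4]],[[3,3,3],[2,2,3],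
       [3,3,4]],[[0,3,0],[0,2,0],[0,4,0]]]),
   Leaf ([[0,2,4,6],[3,7],[5]], [[1,4,7],[2,5,8],[3,6]], [[2,7,12,17,22],
       [3,4,8,9,13,14,18,19,23,24],[6,11,16,21]], [[[0,0,0],[3,3,0],[3,3,0]],[[3,3,3],[2,2,3],
       [3,2,3]],[[0,3,3],[0,1,3],[0,4,4]]]),
   Leaf ([[0,2,4,6],[3,7],[5]], [[1,4,7],[2,5,8],[3,6]], [[2,7,12,17,22],[3,8,13,18,23],
       [4,9,14,19,24],[6,11,16,21]], [[[0,0,0],[2,2,2],[2,1,3]],[[2,2,0],[1,1,0],[2,2,0]],
       [[2,2,2],[1,1,2],[2,2,2]],[[0,2,2],[0,1,2],[0,2,3]]]),
   Leaf ([[0,4],[2,6],[3,7],[5]], [[1,4,7],[2,5,8],[3,6]], [[2,7,12,17,22],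
       [3,4,8,9,13,14,18,19,23,24],[6,11,16,21]], [[[0,0,0,0],[0,2,2,2],[0,3,3,3]],[[2,2,2,2],
       [2,2,2,2],[2,2,1,2]],[[0,0,3,3],[0,0,1,1],[0,0,3,3]]]),
   Leaf ([[0,4],[2,6],[3,7],[5]], [[1,4,7],[2,5,8],[3,6]], [[2,7,12,17,22],[3,8,13,18,23],
       [4,9,14,19,24],[6,11,16,21]], [[[0,0,0,0],[6,5,5,6],[7,6,3,7]],[[0,6,6,6],[0,5,5,5],
       [0,7,7,7]],[[5,6,6,6],[6,5,6,6],[7,6,5,2]],[[0,0,7,7],[0,0,2,2],[0,0,9,9]]]),
   Leaf ([[0,2,3,4,6,7],[5]], [[1,4,7],[2,5,8],[3,6]], [[2,7,12,17,22],
       [3,4,8,9,13,14,18,19,23,24],[6,11,16,21]], [[[0,0],[2,2],[2,2]],[[2,2],[1,1],[2,2]],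
       [[0,2],[0,2],[0,2]]]),
   Leaf ([[0,2,4,6],[3,7],[5]], [[1,4,7],[2,5,8],[3,6]], [[2,7,12,17,22],
       [3,4,8,9,13,14,18,19,23,24],[6,11,16,21]], [[[0,0,0],[2,0,2],[2,0,2]],[[2,2,2],[1,2,2],
       [2,2,2]],[[0,2,3],[0,2,1],[0,3,3]]]),
   Leaf ([[0,2,4,6],[3,7],[5]], [[1,4,7],[2,5,8],[3,6]], [[2,7,12,17,22],[3,8,13,18,23],
       [4,9,14,19,24],[6,11,16,21]], [[[0,0,0],[2,2,2],[2,2,2]],[[2,0,2],[1,0,1],[2,0,2]],
       [[2,2,2],[1,1,1],[2,2,2]],[[0,2,2],[0,1,1],[0,2,2]]]),
   Split (8,1,1),
   Leaf ([[1,3,5,7],[2,4,6]], [[1,4,7],[2,5,8],[3,6]], [[2,7,12,17,22],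
       [3,4,8,9,13,14,18,19,23,24],[6,11,16,21]], [[[0,0],[4,0],[8,0]],[[8,8],[8,8],[7,10]],
       [[10,10],[5,10],[9,12]]]),
   Leaf ([[0,2,4,6],[3,5,7]], [[1,4,7],[2,5,8],[3,6]], [[2,7,12,17,22],
       [3,4,8,9,13,14,18,19,23,24],[6,11,16,21]], [[[0,0],[0,6],[0,6]],[[5,6],[5,4],[6,5]],
       [[5,6],[5,4],[7,7]]]),
   Split (8,1,1),
   Split (4,3,1),
   Leaf ([[1,3,5,7],[2,6],[4]], [[1,4,7],[2,5,8],[3,6]], [[2,7,12,17,22],[3,8,13,18,23],
       [4,9,14,19,24],[6,11,16,21]], [[[0,0,0],[3,3,2],[3,4,0]],[[3,0,0],[3,0,0],[3,0,0]],
       [[3,2,4],[3,3,4],[3,4,0]],[[4,2,5],[1,4,4],[4,5,0]]]),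
   Leaf ([[1,3,5,7],[2,6],[4]], [[1,4,7],[2,5,8],[3,6]], [[2,7,12,17,22],[3,8,13,18,23],
       [4,9,14,19,24],[6,11,16,21]], [[[0,0,0],[3,3,3],[2,4,5]],[[3,0,0],[2,0,0],[3,0,0]],
       [[3,3,0],[3,3,3],[3,2,5]],[[4,3,0],[2,4,4],[2,4,6]]]),
   Leaf ([[1,3,5,7],[2,6],[4]], [[1,4,7],[2,5,8],[3,6]], [[2,7,12,17,22],[3,8,13,18,23],
       [4,9,14,19,24],[6,11,16,21]], [[[0,0,0],[3,3,0],[2,4,4]],[[3,0,0],[2,0,0],[3,0,0]],
       [[3,2,4],[2,3,0],[3,2,4]],[[3,3,5],[2,3,0],[3,4,5]]]),
   Leaf ([[1,3,5,7],[2,6],[4]], [[1,4,7],[2,5,8],[3,6]], [[2,7,12,17,22],[3,8,13,18,23],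
       [4,9,14,19,24],[6,11,16,21]], [[[0,0,0],[7,9,9],[7,0,13]],[[7,0,0],[6,0,0],[7,0,0]],
       [[7,9,9],[6,9,9],[7,0,5]],[[9,11,7],[3,11,11],[9,0,12]]]),
   Leaf ([[1,3,5,7],[2,6],[4]], [[1,4,7],[2,5,8],[3,6]], [[2,7,12,17,22],[3,8,13,18,23],
       [4,9,14,19,24],[6,11,16,21]], [[[0,0,0],[3,4,4],[3,4,4]],[[3,0,0],[2,0,0],[3,0,0]],
       [[3,0,4],[2,4,4],[3,4,4]],[[4,0,5],[2,5,5],[4,5,5]]]),
   Split (2,3,1),
   Leaf ([[1,3,5,7],[2,6],[4]], [[1,4,7],[2,5,8],[3,6]], [[2,7,12,17,22],[3,8,13,18,23],
       [4,6,9,11,14,16,19,21,24]], [[[0,0,0],[1,0,1],[1,0,0]],[[1,0,0],[1,0,0],[1,0,0]],[[1,1,1],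
       [1,0,1],[1,0,0]]]),
   Leaf ([[1,3,5,7],[2,6],[4]], [[1,4,7],[2,5,8],[3,6]], [[2,7,12,17,22],[3,8,13,18,23],
       [4,6,9,11,14,16,19,21,24]], [[[0,0,0],[1,0,1],[1,1,1]],[[1,0,0],[1,0,0],[1,0,0]],[[1,0,0],
       [1,0,1],[1,1,1]]]),
   Leaf ([[1,3,5,7],[2,4,6]], [[1,4,7],[2,5,8],[3,6]], [[2,7,12,17,22],[3,8,13,18,23],
       [4,6,9,11,14,16,19,21,24]], [[[0,0],[1,0],[1,1]],[[1,0],[1,0],[1,0]],[[1,1],[1,0],
       [1,1]]]),
   Leaf ([[1,3,5,7],[2,6],[4]], [[1,4,7],[2,5,8],[3,6]], [[2,7,12,17,22],[3,8,13,18,23],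
       [4,6,9,11,14,16,19,21,24]], [[[0,0,0],[1,0,1],[0,1,1]],[[1,0,0],[1,0,0],[0,0,0]],[[1,1,0],
       [1,0,1],[0,1,1]]]),
   Leaf ([[1,3,5,7],[2,6],[4]], [[1,4,7],[2,5,8],[3,6]], [[2,7,12,17,22],[3,8,13,18,23],
       [4,9,14,19,24],[6,11,16,21]], [[[0,0,0],[1,0,1],[0,1,1]],[[0,0,0],[1,0,0],[1,0,0]],
       [[0,1,1],[1,0,1],[1,1,0]],[[0,1,1],[1,0,1],[1,1,1]]]),
   Leaf ([[1,3,5,7],[2,6],[4]], [[1,4,7],[2,5,8],[3,6]], [[2,7,12,17,22],[3,8,13,18,23],
       [4,9,14,19,24],[6,11,16,21]], [[[0,0,0],[0,0,3],[2,4,4]],[[3,0,0],[0,0,0],[3,0,0]],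
       [[3,3,3],[0,0,3],[3,3,3]],[[3,3,3],[0,0,3],[3,4,4]]]),
   Split (2,9,1),
   Leaf ([[1,5],[2,4,6],[3,7]], [[1,4,7],[2,5,8],[3],[6]], [[2,7,12,17,22],[3,8,13,18,23],
       [4,9,14,19,24],[6,11,16,21]], [[[0,0,0],[2,2,2],[0,0,2],[0,2,2]],[[2,0,2],[2,0,1],[0,0,2],
       [0,0,2]],[[2,2,2],[2,2,1],[0,0,2],[0,2,2]],[[2,2,2],[0,2,2],[0,0,1],[0,3,1]]]),
   Leaf ([[1,5],[2,4,6],[3,7]], [[1],[2,5,8],[3,6],[4,7]], [[2,7,12,17,22],[3,8,13,18,23],
       [4,9,14,19,24],[6,11,16,21]], [[[0,0,0],[1,2,2],[0,2,2],[0,0,0]],[[1,0,2],[2,0,1],[0,0,2],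
       [2,0,1]],[[2,0,1],[2,2,1],[0,2,2],[1,1,2]],[[3,0,2],[1,2,2],[0,3,2],[2,2,2]]]),
   Leaf ([[1,5],[2,6],[3,7],[4]], [[1,4,7],[2],[3,6],[5,8]], [[2,7,12,17,22],[3,8,13,18,23],
       [4,9,14,19,24],[6,11,16,21]], [[[0,0,0,0],[1,0,2,0],[0,2,1,2],[1,2,0,2]],[[1,0,1,0],
       [1,0,0,0],[0,0,2,0],[1,0,1,0]],[[1,1,1,1],[1,0,1,0],[0,2,1,1],[0,2,1,2]],[[1,1,1,1],
       [2,0,1,0],[0,2,1,2],[0,2,1,2]]]),
   Leaf ([[1,5],[2,6],[3,7],[4]], [[1,4,7],[2,5,8],[3],[6]], [[2,7,12,17,22],[3,8,13,18,23],
       [4,9,14,19,24],[6,11,16,21]], [[[0,0,0,0],[1,4,4,4],[0,5,0,6],[0,5,3,6]],[[4,0,4,0],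
       [4,0,4,0],[0,0,0,0],[0,0,3,0]],[[4,2,4,3],[3,4,2,4],[0,5,0,4],[0,5,5,4]],[[5,3,5,3],
       [5,5,2,5],[0,6,0,6],[0,6,4,6]]]),
   Leaf ([[1,5],[2,4,6],[3,7]], [[1],[2,5,8],[3,6],[4,7]], [[2,7,12,17,22],[3,8,13,18,23],
       [4,9,14,19,24],[6,11,16,21]], [[[0,0,0],[1,3,3],[0,4,1],[0,0,0]],[[0,0,0],[3,0,0],[0,0,4],
       [3,0,3]],[[0,4,0],[3,2,1],[0,3,3],[3,1,3]],[[0,4,0],[1,3,2],[0,4,2],[4,0,4]]]),
   Leaf ([[1,5],[2,4,6],[3,7]], [[1,4,7],[2],[3,6],[5,8]], [[2,7,12,17,22],[3,8,13,18,23],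
       [4,9,14,19,24],[6,11,16,21]], [[[0,0,0],[0,2,0],[0,2,1],[1,1,1]],[[1,0,1],[0,0,0],[0,0,2],
       [1,0,1]],[[1,1,1],[0,2,0],[0,2,1],[1,1,2]],[[1,1,1],[0,2,0],[0,2,2],[2,1,1]]]),
   Split (8,3,1),
   Leaf ([[1,5],[2,6],[3,7],[4]], [[1,4,7],[2,5,8],[3,6]], [[2,7,12,17,22],[3,8,13,18,23],
       [4,9,14,19,24],[6,11,16,21]], [[[0,0,0,0],[0,3,2,3],[3,3,1,0]],[[0,0,3,0],[3,0,1,0],
       [2,0,3,0]],[[0,3,3,3],[1,3,2,3],[3,2,2,0]],[[0,3,4,4],[3,3,1,4],[1,4,4,0]]]),
   Leaf ([[1,5],[2,6],[3,7],[4]], [[1,4,7],[2,5,8],[3,6]], [[2,7,12,17,22],[3,8,13,18,23],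
       [4,9,14,19,24],[6,11,16,21]], [[[0,0,0,0],[0,1,2,2],[1,2,0,2]],[[0,0,2,0],[2,0,0,0],
       [1,0,2,0]],[[0,2,2,0],[1,1,0,2],[2,0,1,2]],[[0,2,2,0],[1,1,0,2],[1,1,2,2]]]),
   Leaf ([[1,5],[2,6],[3,7],[4]], [[1,4,7],[2,5,8],[3,6]], [[2,7,12,17,22],[3,8,13,18,23],
       [4,9,14,19,24],[6,11,16,21]], [[[0,0,0,0],[0,3,3,0],[3,3,0,3]],[[0,0,3,0],[3,0,0,0],
       [2,0,3,0]],[[0,2,3,3],[2,3,1,0],[3,1,2,3]],[[0,1,4,4],[2,4,0,0],[1,3,4,4]]]),
   Leaf ([[1],[2,4,6],[3,7],[5]], [[1,4,7],[2,5,8],[3,6]], [[2,7,12,17,22],[3,8,13,18,23],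
       [4,9,14,19,24],[6,11,16,21]], [[[0,0,0,0],[2,2,0,2],[0,2,1,2]],[[0,0,2,0],[2,0,1,2],
       [0,0,2,2]],[[0,2,2,0],[0,2,2,0],[0,2,2,0]],[[0,2,2,0],[0,2,1,2],[0,2,1,2]]]),
   Leaf ([[1],[2,4,6],[3,7],[5]], [[1,4,7],[2,5,8],[3,6]], [[2,7,12,17,22],[3,8,13,18,23],
       [4,9,14,19,24],[6,11,16,21]], [[[0,0,0,0],[0,1,0,1],[0,1,0,1]],[[0,0,1,0],[0,0,1,1],
       [1,0,0,1]],[[0,1,1,0],[0,1,1,1],[1,1,1,0]],[[0,1,1,0],[0,1,1,0],[1,1,1,0]]]),
   Leaf ([[1,5],[2],[3,7],[4,6]], [[1,4,7],[2,5,8],[3,6]], [[2,7,12,17,22],[3,8,13,18,23],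
       [4,9,14,19,24],[6,11,16,21]], [[[0,0,0,0],[2,2,0,2],[1,0,0,3]],[[0,0,2,0],[2,0,1,0],
       [2,0,2,0]],[[0,2,2,2],[1,2,1,2],[2,0,2,1]],[[0,2,2,2],[2,2,1,2],[1,0,3,2]]]),
   Leaf ([[1,5],[2],[3,7],[4],[6]], [[1,4,7],[2,5,8],[3,6]], [[2,7,12,17,22],[3,8,13,18,23],
       [4,9,14,19,24],[6,11,16,21]], [[[0,0,0,0,0],[0,2,2,2,1],[0,2,2,2,2]],[[0,0,2,0,0],
       [2,0,1,0,0],[2,0,1,0,0]],[[0,0,2,2,2],[2,1,0,2,2],[2,1,1,1,1]],[[0,0,2,2,2],[1,1,0,2,2],
       [2,2,1,2,2]]]),
   Leaf ([[1,5],[2],[3,7],[4,6]], [[1,4,7],[2,5,8],[3,6]], [[2,7,12,17,22],[3,8,13,18,23],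
       [4,9,14,19,24],[6,11,16,21]], [[[0,0,0,0],[0,0,1,1],[1,1,0,1]],[[0,0,1,0],[1,0,0,0],
       [0,0,1,0]],[[0,0,1,1],[1,0,0,1],[1,1,0,1]],[[0,0,1,1],[1,0,0,1],[0,1,1,1]]]),
   Leaf ([[1,5],[2,4,6],[3],[7]], [[1,4,7],[2,5,8],[3,6]], [[2,7,12,17,22],[3,8,13,18,23],
       [4,6,9,11,14,16,19,21,24]], [[[0,0,0,0],[1,2,0,2],[2,2,0,0]],[[0,0,2,2],[2,0,2,0],
       [2,0,0,2]],[[0,2,2,2],[1,2,2,0],[1,2,0,2]]]),
   Leaf ([[1,5],[2,6],[3],[4],[7]], [[1,4,7],[2,5,8],[3,6]], [[2,7,12,17,22],[3,8,13,18,23],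
       [4,9,14,19,24],[6,11,16,21]], [[[0,0,0,0,0],[3,5,0,10,10],[3,6,0,10,10]],[[0,0,0,0,10],
       [5,0,9,0,0],[6,0,10,0,1]],[[0,5,0,10,10],[4,5,9,10,0],[6,4,10,8,0]],[[0,6,0,12,12],
       [6,6,0,12,0],[6,6,12,12,0]]]),
   Leaf ([[1,5],[2,4,6],[3],[7]], [[1,4,7],[2,5,8],[3,6]], [[2,7,12,17,22],[3,8,13,18,23],
       [4,9,14,19,24],[6,11,16,21]], [[[0,0,0,0],[0,1,0,1],[1,1,0,0]],[[0,0,1,1],[1,0,0,1],
       [1,0,1,1]],[[0,1,1,1],[1,1,0,1],[1,1,1,1]],[[0,1,1,1],[1,1,0,0],[0,1,1,1]]]),
   Split (8,3,1),
   Leaf ([[1,5],[2,6],[3,7],[4]], [[1,4,7],[2,5,8],[3,6]], [[2,7,12,17,22],[3,8,13,18,23],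
       [4,9,14,19,24],[6,11,16,21]], [[[0,0,0,0],[0,2,2,2],[1,2,2,0]],[[2,0,1,0],[0,0,2,0],
       [2,0,1,0]],[[2,1,1,2],[0,1,2,2],[1,2,1,0]],[[1,1,1,2],[0,1,2,2],[2,2,1,0]]]),
   Leaf ([[1,5],[2,6],[3,7],[4]], [[1,4,7],[2,5,8],[3,6]], [[2,7,12,17,22],[3,8,13,18,23],
       [4,9,14,19,24],[6,11,16,21]], [[[0,0,0,0],[0,2,2,2],[0,2,1,2]],[[2,0,1,0],[0,0,2,0],
       [2,0,1,0]],[[2,2,1,0],[0,2,2,2],[2,0,1,2]],[[1,2,2,0],[0,1,2,2],[2,1,1,3]]]),
   Leaf ([[1,5],[2,6],[3,7],[4]], [[1,4,7],[2,5,8],[3,6]], [[2,7,12,17,22],[3,8,13,18,23],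
       [4,9,14,19,24],[6,11,16,21]], [[[0,0,0,0],[0,3,3,0],[0,3,2,3]],[[3,0,1,0],[0,0,3,0],
       [3,0,2,0]],[[3,2,1,3],[0,3,3,0],[2,0,2,3]],[[1,2,3,3],[0,3,2,0],[3,2,2,4]]]),
   Leaf ([[1],[2,6],[3,7],[4],[5]], [[1,4,7],[2,5,8],[3,6]], [[2,7,12,17,22],[3,8,13,18,23],
       [4,9,14,19,24],[6,11,16,21]], [[[0,0,0,0,0],[0,1,1,1,0],[0,1,1,1,1]],[[1,0,0,0,1],
       [0,0,1,0,0],[0,0,1,0,1]],[[1,1,0,1,1],[0,1,1,0,0],[0,0,1,1,1]],[[0,1,1,1,1],[0,1,1,1,0],
       [0,1,1,1,1]]]),
   Leaf ([[1],[2,4,6],[3,7],[5]], [[1,4,7],[2,5,8],[3,6]], [[2,7,12,17,22],[3,8,13,18,23],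
       [4,9,14,19,24],[6,11,16,21]], [[[0,0,0,0],[0,1,1,0],[0,1,0,1]],[[0,0,1,1],[0,0,1,0],
       [1,0,1,1]],[[0,1,1,1],[0,1,1,0],[1,1,1,1]],[[0,1,1,1],[0,1,1,0],[1,1,1,0]]]),
   Leaf ([[1,5],[2],[3,7],[4,6]], [[1,4,7],[2,5,8],[3,6]], [[2,7,12,17,22],[3,8,13,18,23],
       [4,9,14,19,24],[6,11,16,21]], [[[0,0,0,0],[0,1,1,1],[1,0,0,2]],[[1,0,1,0],[0,0,1,0],
       [1,0,1,0]],[[1,1,1,1],[0,1,1,1],[1,0,1,1]],[[1,1,1,1],[0,1,1,1],[1,0,1,2]]]),
   Leaf ([[1,5],[2],[3,7],[4],[6]], [[1,4,7],[2,5,8],[3,6]], [[2,7,12,17,22],[3,8,13,18,23],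
       [4,9,14,19,24],[6,11,16,21]], [[[0,0,0,0,0],[0,2,2,2,2],[1,2,1,2,2]],[[2,0,1,0,0],
       [0,0,2,0,0],[2,0,1,0,0]],[[2,0,1,2,2],[0,2,2,2,2],[2,2,1,1,0]],[[2,0,0,2,2],[0,1,2,2,2],
       [2,2,1,2,2]]]),
   Leaf ([[1,5],[2],[3,7],[4],[6]], [[1,4,7],[2,5,8],[3,6]], [[2,7,12,17,22],[3,8,13,18,23],
       [4,9,14,19,24],[6,11,16,21]], [[[0,0,0,0,0],[0,0,2,3,3],[2,2,0,3,3]],[[2,0,1,0,0],
       [0,0,2,0,0],[3,0,1,0,0]],[[2,2,1,2,2],[0,0,2,3,3],[2,3,2,1,0]],[[2,3,1,1,2],[0,0,3,3,3],
       [1,3,3,3,2]]]),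
   Leaf ([[1,5],[2,6],[3],[4],[7]], [[1,4,7],[2,5,8],[3,6]], [[2,7,12,17,22],[3,8,13,18,23],
       [4,9,14,19,24],[6,11,16,21]], [[[0,0,0,0,0],[0,1,1,1,1],[1,1,0,1,1]],[[1,0,0,0,1],
       [0,0,1,0,1],[1,0,0,0,1]],[[1,1,0,1,1],[0,1,1,1,1],[1,0,0,1,1]],[[0,1,0,1,1],[0,1,1,1,1],
       [1,1,0,1,1]]]),
   Leaf ([[1,5],[2,4,6],[3],[7]], [[1,4,7],[2,5,8],[3,6]], [[2,7,12,17,22],[3,8,13,18,23],
       [4,9,14,19,24],[6,11,16,21]], [[[0,0,0,0],[0,1,1,1],[1,1,0,0]],[[1,0,0,1],[0,0,1,1],
       [1,0,1,0]],[[1,1,0,1],[0,1,1,1],[1,1,1,1]],[[1,1,0,1],[0,1,1,1],[1,1,1,0]]]),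
   Leaf ([[1,5],[2,6],[3],[4],[7]], [[1,4,7],[2,5,8],[3,6]], [[2,7,12,17,22],[3,8,13,18,23],
       [4,9,14,19,24],[6,11,16,21]], [[[0,0,0,0,0],[0,3,0,6,6],[3,4,6,6,0]],[[3,0,0,0,6],
       [0,0,0,0,6],[4,0,6,0,0]],[[3,3,0,6,6],[0,3,0,5,6],[4,4,6,5,0]],[[2,4,0,6,8],[0,4,0,6,8],
       [4,4,8,8,0]]]),
   Split (4,1,5),
   Leaf ([[0,2,4,6],[3,7],[5]], [[1,4,7],[2,5,8],[3,6]], [[2,7,12,17,22],[3,8,13,18,23],
       [4,9,14,19,24],[6,11,16,21]], [[[0,0,0],[4,4,6],[4,4,6]],[[0,4,6],[0,3,3],[0,4,6]],
       [[4,4,6],[4,3,3],[4,4,5]],[[5,5,0],[2,2,0],[5,5,0]]]),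
   Leaf ([[0,2,4,6],[3,7],[5]], [[1,4,7],[2,5,8],[3,6]], [[2,7,12,17,22],[3,8,13,18,23],
       [4,9,14,19,24],[6,11,16,21]], [[[0,0,0],[2,2,0],[2,2,0]],[[0,2,2],[0,1,2],[0,2,2]],
       [[2,2,2],[2,2,2],[2,1,2]],[[2,2,2],[1,1,2],[2,2,3]]]),
   Leaf ([[0,2,4,6],[3,7],[5]], [[1,4,7],[2,5,8],[3,6]], [[2,7,12,17,22],[3,8,13,18,23],
       [4,9,14,19,24],[6,11,16,21]], [[[0,0,0],[4,4,4],[4,3,6]],[[0,4,0],[0,3,0],[0,4,0]],
       [[4,4,4],[4,4,4],[4,4,5]],[[5,5,5],[2,2,5],[5,5,6]]]),
   Leaf ([[0,2,4,6],[3,7],[5]], [[1,4,7],[2,5,8],[3,6]], [[2,7,12,17,22],[3,8,13,18,23],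
       [4,9,14,19,24],[6,11,16,21]], [[[0,0,0],[5,5,5],[6,2,7]],[[0,5,5],[0,4,4],[0,6,7]],
       [[5,5,0],[4,4,0],[6,6,0]],[[6,6,7],[3,3,7],[6,6,7]]]),
   Leaf ([[0,4],[2,6],[3,7],[5]], [[1,4,7],[2,5,8],[3,6]], [[2,7,12,17,22],[3,8,13,18,23],
       [4,9,14,19,24],[6,11,16,21]], [[[0,0,0,0],[12,10,4,12],[14,14,7,14]],[[0,0,12,12],
       [0,0,10,10],[0,0,14,14]],[[12,10,12,12],[10,12,12,4],[14,14,11,6]],[[0,15,15,15],
       [0,13,13,13],[0,17,17,17]]]),
   Leaf ([[0,4],[2,6],[3,7],[5]], [[1,4,7],[2,5,8],[3,6]], [[2,7,12,17,22],[3,8,13,18,23],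
       [4,9,14,19,24],[6,11,16,21]], [[[0,0,0,0],[0,3,3,3],[0,4,3,4]],[[0,0,3,3],[0,0,1,1],
       [0,0,4,4]],[[2,3,3,3],[2,2,2,2],[4,2,1,3]],[[3,3,3,3],[3,3,3,3],[4,4,3,0]]]),
   Split (2,1,25),
   Leaf ([[0,4],[2,6],[3,7],[5]], [[1,4,7],[2,5,8],[3,6]], [[2,7,12,17,22],[3,8,13,18,23],
       [4,9,14,19,24],[6],[11,16,21]], [[[0,0,0,0],[8,4,5,6],[8,8,4,0]],[[0,0,8,8],[0,0,8,8],
       [0,0,8,8]],[[0,8,8,8],[0,8,0,8],[0,8,8,8]],[[0,0,10,10],[0,0,10,10],[0,0,10,10]],
       [[10,10,3,10],[10,10,8,0],[10,10,3,10]]]),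
   Leaf ([[0,4],[2,6],[3,7],[5]], [[1,4,7],[2,5,8],[3,6]], [[2],[3,8,13,18,23],[4,9,14,19,24],
       [6,11,16,21],[7,12,17,22]], [[[0,0,0,0],[0,0,0,0],[0,0,1,1]],[[0,0,1,1],[0,0,1,1],
       [0,0,1,1]],[[0,1,1,1],[0,1,1,1],[0,1,1,1]],[[1,1,1,1],[1,1,0,1],[1,1,1,0]],[[0,0,0,0],
       [1,1,1,0],[1,1,0,1]]]),
   Leaf ([[0,4],[2,6],[3,7],[5]], [[1,4,7],[2,5,8],[3,6]], [[2,7,12,17,22],[3,8,13,18,23],[4],
       [6,11,16,21],[9,14,19,24]], [[[0,0,0,0],[3,2,3,3],[4,3,2,0]],[[0,0,3,3],[0,0,2,2],
       [0,0,4,4]],[[0,0,3,0],[0,0,0,3],[0,0,2,4]],[[3,3,3,3],[3,3,2,3],[4,4,1,3]],[[0,3,2,3],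
       [0,3,2,0],[0,4,4,4]]]),
   Leaf ([[0,4],[2,6],[3,7],[5]], [[1,4,7],[2,5,8],[3,6]], [[2,7,12,17,22],[3,8,13,18,23],
       [4,9,14,19,24],[6],[11,16,21]], [[[0,0,0,0],[2,3,2,2],[3,2,2,1]],[[0,0,3,3],[0,0,2,2],
       [0,0,3,3]],[[0,3,3,3],[0,2,2,2],[0,3,3,3]],[[3,3,0,0],[3,3,0,0],[3,3,0,0]],[[3,3,3,3],
       [3,3,3,3],[3,3,2,3]]]),
   Leaf ([[0,4],[2,6],[3,7],[5]], [[1,4,7],[2,5,8],[3,6]], [[2],[3,8,13,18,23],[4,9,14,19,24],
       [6,11,16,21],[7,12,17,22]], [[[0,0,0,0],[1,0,0,0],[1,1,0,0]],[[0,0,1,1],[0,0,1,1],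
       [0,0,1,1]],[[0,1,1,1],[0,1,1,1],[0,1,1,1]],[[1,1,1,1],[1,1,1,0],[1,1,1,0]],[[0,0,0,0],
       [1,1,0,1],[1,1,0,1]]]),
   Leaf ([[0,4],[2,6],[3,7],[5]], [[1,4,7],[2,5,8],[3,6]], [[2,7,12,17,22],[4,9,14,19,24],
       [6,11,16,21],[8,13,18,23]], [[[0,0,0,0],[4,3,2,4],[5,4,1,5]],[[0,4,4,4],[0,3,3,3],
       [0,5,5,5]],[[4,4,4,4],[4,4,4,2],[6,5,4,0]],[[0,0,4,4],[0,0,3,3],[0,0,6,6]]]),
   Leaf ([[0,4],[2,6],[3,7],[5]], [[1,4,7],[2,5,8],[3,6]], [[2,7,12,17,22],[3,8,13,18,23],[4],
       [6,11,16,21],[9,14,19,24]], [[[0,0,0,0],[3,3,1,3],[4,3,1,4]],[[0,0,3,3],[0,0,2,2],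
       [0,0,4,4]],[[0,4,0,0],[0,0,0,0],[0,5,0,0]],[[3,4,4,4],[4,3,4,4],[4,4,4,0]],[[0,3,4,4],
       [0,3,3,1],[0,4,5,5]]]),
   Leaf ([[0,2,4,6],[3,7],[5]], [[1,4,7],[2,5,8],[3,6]], [[2,7,12,17,22],[3,8,13,18,23],
       [4,9,14,19,24],[6,11,16,21]], [[[0,0,0],[2,2,2],[2,2,2]],[[0,2,2],[0,1,1],[0,2,2]],
       [[2,2,2],[1,1,1],[2,2,2]],[[2,0,2],[1,0,2],[2,0,2]]]),
   Leaf ([[0,2,4,6],[3,7],[5]], [[1,4,7],[2,5,8],[3,6]], [[2,7,12,17,22],[3,8,13,18,23],
       [4,9,14,19,24],[6,11,16,21]], [[[0,0,0],[3,0,3],[3,0,5]],[[0,3,3],[0,3,1],[0,3,5]],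
       [[3,3,3],[2,3,3],[3,3,1]],[[3,3,3],[2,3,3],[3,3,4]]]),
   Leaf ([[0,2,3,4,6,7],[5]], [[1,4,7],[2,5,8],[3,6]], [[2,7,12,17,22],[3,8,13,18,23],
       [4,9,14,19,24],[6,11,16,21]], [[[0,0],[12,13],[12,13]],[[0,13],[0,8],[0,13]],[[12,13],
       [9,8],[12,13]],[[15,15],[4,11],[15,15]]]),
   Leaf ([[0,2,4,6],[3,7],[5]], [[1,4,7],[2,5,8],[3,6]], [[2,7,12,17,22],[3,8,13,18,23],
       [4,9,14,19,24],[6,11,16,21]], [[[0,0,0],[12,12,13],[12,12,13]],[[0,12,13],[0,9,8],
       [0,12,13]],[[12,0,13],[9,0,8],[12,0,13]],[[15,15,15],[4,4,11],[15,15,15]]])]"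
  by code_simp

section \<open>Verifying a covering system\<close>

text \<open>To verify a covering, the integers are split into finer and finer residue classes \<open>r\<close> modulo \<open>d\<close>, each
with the list of congruences that it meets.  A class with a congruence whose modulus divides \<open>d\<close> lies
inside that congruence and is dropped.  This takes a few thousand tests, while trying every residue
modulo the least common multiple would take many more.\<close>

definition meets :: "int \<Rightarrow> int \<Rightarrow> int \<times> int \<Rightarrow> bool" where
  "meets r d c \<longleftrightarrow> (fst c - r) mod gcd (snd c) d = 0"

definition child :: "int \<Rightarrow> int \<Rightarrow> int \<Rightarrow> (int \<times> int) list \<Rightarrow> int \<Rightarrow> int \<times> (int \<times> int) list" where
  "child d e r cs i = (r + i * d, filter (meets (r + i * d) e) cs)"

definition divides :: "int \<Rightarrow> int \<Rightarrow> bool" where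
  "divides e n \<longleftrightarrow> n dvd e"

text \<open>Only congruences that meet the class are left in its list, so divisibility of moduli is enough for
containment.\<close>

definition undecided :: "int \<Rightarrow> int \<times> (int \<times> int) list \<Rightarrow> bool" where
  "undecided e s \<longleftrightarrow> \<not> list_ex (divides e) (map snd (snd s))"

fun refine :: "int \<Rightarrow> int \<Rightarrow> int \<times> (int \<times> int) list \<Rightarrow> (int \<times> (int \<times> int) list) list" where
  "refine d p (r, cs) = filter (undecided (d * p)) (map (child d (d * p) r cs) [0..p - 1])"

fun sweep :: "int \<Rightarrow> (int \<times> (int \<times> int) list) list \<Rightarrow> int list \<Rightarrow> bool" where
  "sweep d ss [] \<longleftrightarrow> ss = []"
| "sweep d ss (p # ps) \<longleftrightarrow> sweep (d * p) (concat (map (refine d p) ss)) ps"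

lemma sweep_sound:
  assumes "sweep d ss ps" "0 < d" "\<forall>p \<in> set ps. 0 < p" "(r, cs) \<in> set ss" "d dvd x - r"
  shows "\<exists>(s, n) \<in> set cs. n dvd x - s"
  using assms
proof (induction ps arbitrary: d ss r cs)
  case (Cons p ps)
  define i where "i = (x - r) div d mod p"
  have p: "0 < p" using Cons.prems by simp
  then have i: "i \<in> set [0..p - 1]" by (simp add: i_def)
  define r' where "r' = r + i * d"
  obtain t where t: "x - r = d * t" using Cons.prems by blast
  have "i = t mod p" using t Cons.prems by (simp add: i_def)
  then have "x - r' = d * p * (t div p)"
    using t by (simp add: r'_def algebra_simps flip: minus_mod_eq_mult_div)
  then have dvd: "d * p dvd x - r'" by simp
  define cs' where "cs' = filter (meets r' (d * p)) cs"
  have child: "child d (d * p) r cs i = (r', cs')" by (simp add: child_def r'_def cs'_def)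
  have "\<exists>(s, n) \<in> set cs'. n dvd x - s"
  proof (cases "undecided (d * p) (r', cs')")
    case True
    then have "(r', cs') \<in> set (concat (map (refine d p) ss))"
    proof -
      have "(r', cs') \<in> set (refine d p (r, cs))"
        using True image_eqI[of "(r', cs')" "child d (d * p) r cs" i] i child by simp
      then show ?thesis using Cons.prems(4) unfolding set_concat set_map by blast
    qed
    then show ?thesis
      by (intro Cons.IH[of "d * p" "concat (map (refine d p) ss)" r' cs'])
        (use Cons.prems p dvd in simp_all)
  next
    case False
    then obtain s n where sn: "(s, n) \<in> set cs'" "n dvd d * p"
      by (auto simp: undecided_def divides_def list_ex_iff)
    moreover have "(s - r') mod gcd n (d * p) = 0" using sn(1) by (simp add: cs'_def meets_def)
    ultimately have "n dvd s - r'"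
      by (metis dvd_eq_mod_eq_0 dvd_gcdD1 dvd_trans gcd_greatest dvd_refl)
    moreover have "n dvd x - r'" using sn(2) dvd by (rule dvd_trans)
    ultimately have "n dvd (x - r') - (s - r')" by (rule dvd_diff[rotated])
    then show ?thesis using sn by (auto simp: algebra_simps)
  qed
  then show ?case by (auto simp: cs'_def)
qed simp

definition admissible :: "int \<Rightarrow> int \<Rightarrow> bool" where
  "admissible l n \<longleftrightarrow> 5 \<le> n \<and> n dvd l"

text \<open>The list \<open>ps\<close> holds the primes by which the classes are split, one after the other.\<close>

definition certified :: "int list \<Rightarrow> (int \<times> int) list \<Rightarrow> bool" where
  "certified ps cs \<longleftrightarrow> distinct (map snd cs) \<and> List.member (map snd cs) 5 \<and>
     list_all (admissible (prod_list ps)) (map snd cs) \<and> sweep 1 [(0, cs)] ps"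

definition system_of :: "(int \<times> int) list \<Rightarrow> congruence set" where
  "system_of cs = set (map (\<lambda>(r, n). (r, nat n)) cs)"

lemma moduli_system_of: "moduli (system_of cs) = nat ` set (map snd cs)"
  by (force simp: moduli_def system_of_def)

lemma certified_imp_system:
  assumes cert: "certified ps cs" and pos: "\<forall>p \<in> set ps. 0 < p"
  shows "distinct_covering_system (system_of cs)" "least_modulus (system_of cs) = 5"
    "modulus_lcm (system_of cs) dvd nat (prod_list ps)"
proof -
  have dist: "distinct (map snd cs)" and five: "5 \<in> set (map snd cs)"
    and adm: "\<And>r n. (r, n) \<in> set cs \<Longrightarrow> 5 \<le> n \<and> n dvd prod_list ps"
    and sweep: "sweep 1 [(0, cs)] ps"
    using cert by (auto simp: certified_def list_all_iff admissible_def)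
  have "\<exists>(r, n) \<in> system_of cs. [x = r] (mod int n)" for x
  proof -
    obtain r n where rn: "(r, n) \<in> set cs" "n dvd x - r"
      using sweep_sound[OF sweep _ pos, of 0 cs x] by auto
    then have "[x = r] (mod int (nat n))"
      using adm[OF rn(1)] by (auto simp: cong_iff_dvd_diff)
    moreover have "(r, nat n) \<in> system_of cs" using rn by (force simp: system_of_def)
    ultimately show ?thesis by blast
  qed
  moreover have "inj_on snd (system_of cs)"
  proof -
    have "inj_on nat (set (map snd cs))" using adm by (force simp: inj_on_def eq_nat_nat_iff)
    then have "distinct (map snd (map (\<lambda>(r, n). (r, nat n)) cs))"
      using dist by (simp add: comp_def split_beta distinct_map inj_on_def)
    then show ?thesis by (simp only: system_of_def distinct_map)
  qed
  moreover have big: "5 \<le> n" if "n \<in> moduli (system_of cs)" for n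
    using that adm by (force simp: moduli_system_of)
  ultimately show "distinct_covering_system (system_of cs)"
    by (force simp: distinct_covering_system_def covering_system_def moduli_def system_of_def)
  have "5 \<in> moduli (system_of cs)" using five by (force simp: moduli_system_of)
  then show "least_modulus (system_of cs) = 5"
    unfolding least_modulus_def using big by (intro Min_eqI) (auto simp: moduli_system_of)
  show "modulus_lcm (system_of cs) dvd nat (prod_list ps)"
    unfolding modulus_lcm_def
    using adm by (intro Lcm_least) (force simp: moduli_system_of nat_dvd_iff)
qed

section \<open>Four covering systems with least modulus \<open>5\<close>\<close>

text \<open>These systems come from a local search that moves one congruence at a time so as to reduce the number
of uncovered residues.  The splitting primes are ordered so that the classes are decided early.\<close>

definition system1440 :: "(int \<times> int) list" where
  "system1440 = [
    (0, 5), (1, 6), (6, 8), (3, 9), (6, 10), (11, 12), (8, 15), (2, 16), (9, 18), (4, 20),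
    (17, 24), (28, 30), (29, 32), (15, 36), (12, 40), (33, 45), (5, 48), (52, 60), (33, 72),
    (42, 80), (18, 90), (77, 96), (32, 120), (69, 144), (74, 160), (132, 180), (154, 240),
    (141, 288), (72, 360), (314, 480), (234, 720), (474, 1440)]"

lemma certified_system1440: "certified [2, 3, 5, 2, 2, 3, 2, 2] system1440"
  by code_simp

definition system2160 :: "(int \<times> int) list" where
  "system2160 = [
    (2, 5), (5, 6), (0, 8), (1, 9), (3, 10), (2, 12), (0, 15), (12, 16), (7, 18), (19, 20),
    (18, 24), (22, 27), (21, 30), (34, 36), (14, 40), (21, 45), (20, 48), (13, 54), (9, 60),
    (52, 72), (4, 80), (6, 90), (94, 108), (78, 120), (31, 135), (4, 144), (58, 216), (228, 240),
    (85, 270), (126, 360), (166, 432), (409, 540), (36, 720), (598, 1080), (2110, 2160)]"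

lemma certified_system2160: "certified [2, 3, 5, 2, 3, 2, 2, 3] system2160"
  by code_simp

definition system3600 :: "(int \<times> int) list" where
  "system3600 = [
    (4, 5), (4, 6), (3, 8), (2, 9), (3, 10), (0, 12), (0, 15), (10, 16), (8, 18), (17, 20),
    (6, 24), (25, 30), (32, 36), (7, 40), (5, 45), (18, 48), (11, 50), (21, 60), (14, 72),
    (31, 75), (31, 80), (35, 90), (1, 120), (50, 144), (91, 150), (161, 180), (101, 200),
    (41, 225), (231, 240), (41, 360), (151, 400), (131, 450), (421, 600), (71, 720), (871, 1200),
    (221, 1800), (2471, 3600)]"

lemma certified_system3600: "certified [2, 3, 5, 2, 2, 3, 2, 5] system3600"
  by code_simp

definition system5400 :: "(int \<times> int) list" where
  "system5400 = [
    (0, 5), (1, 6), (6, 8), (3, 9), (6, 10), (11, 12), (8, 15), (9, 18), (12, 20), (5, 24),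
    (24, 25), (15, 27), (28, 30), (29, 36), (2, 40), (33, 45), (34, 50), (51, 54), (4, 60),
    (41, 72), (14, 75), (18, 90), (44, 100), (33, 108), (17, 120), (114, 135), (104, 150),
    (161, 180), (194, 200), (87, 216), (189, 225), (24, 270), (154, 300), (89, 360), (54, 450),
    (411, 540), (514, 600), (159, 900), (627, 1080), (1779, 1800)]"

lemma certified_system5400: "certified [2, 3, 5, 2, 3, 2, 5, 3] system5400"
  by code_simp

section \<open>Exponents of covering systems with least modulus \<open>5\<close>\<close>

lemma no_covering:
  assumes "check (powers 2 a, powers 3 b, powers 5 c) [[]] ss"
    and "distinct_covering_system C" "least_modulus C = 5"
    and "modulus_lcm C dvd 2 ^ a * 3 ^ b * 5 ^ c"
  shows False
  using no_grid_cover[OF assms(1)] grid_cover_from_covering[OF assms(2-4)] by blast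

lemma no_covering_15:
  assumes "distinct_covering_system C" "least_modulus C = 5"
    and "modulus_lcm C dvd 2 ^ a * 3 ^ 1 * 5 ^ 1"
  shows False
proof -
  have "powers 3 1 = [1, 3]" "powers 5 1 = [1, 5]" by (simp_all add: powers_def)
  then show ?thesis
    using grid_cover_from_covering[OF assms] no_grid_cover_15 by metis
qed

lemma powers_eqs: "powers 2 3 = [1,2,4,8]" "powers 2 4 = [1,2,4,8,16]" "powers 3 2 = [1,3,9]" 
  "powers 3 3 = [1,3,9,27]" "powers 5 1 = [1,5]" "powers 5 2 = [1,5,25]"
  by (simp_all add: powers_def numeral_eq_Suc)

lemma modulus_lcm_eqI:
  assumes "modulus_lcm C dvd l" "\<And>d. (\<And>n. n \<in> moduli C \<Longrightarrow> n dvd d) \<Longrightarrow> l dvd d"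
  shows "modulus_lcm C = l"
  using assms by (intro dvd_antisym) (auto simp: modulus_lcm_def)

(* (i), (ii), (iv) hold for all systems with the given shape; (iii), (v), (vi), (vii)
   are existence claims.  The hypothesis b = 2 in (iv) is required: (vi) has a = 4, c = 1. *)

theorem theorem1p7:
  "(\<forall>C (a::nat) (b::nat) (c::nat).
      distinct_covering_system C \<and> least_modulus C = 5 \<and>
      modulus_lcm C = 2 ^ a * 3 ^ b * 5 ^ c \<and>
      0 < a \<and> 0 < b \<and> 0 < c \<and> a \<ge> b \<and> b \<ge> c \<longrightarrow>
        b \<ge> 2 \<and>
        (a = 3 \<longrightarrow> b \<ge> 3 \<and> c \<ge> 2) \<and>
        (a = 4 \<and> b = 2 \<longrightarrow> c \<ge> 2)) \<and>
   (\<exists>C. distinct_covering_system C \<and> least_modulus C = 5 \<and>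
      modulus_lcm C = 2 ^ 3 * 3 ^ 3 * 5 ^ 2 \<and>
      (\<forall>n \<in> moduli C. \<not> 675 dvd n)) \<and>
   (\<exists>C. distinct_covering_system C \<and> least_modulus C = 5 \<and>
      modulus_lcm C = 2 ^ 4 * 3 ^ 2 * 5 ^ 2 \<and>
      25 \<notin> moduli C \<and> 100 \<notin> moduli C \<and> 300 \<notin> moduli C \<and> 900 \<notin> moduli C) \<and>
   (\<exists>C. distinct_covering_system C \<and> least_modulus C = 5 \<and>
      modulus_lcm C = 2 ^ 4 * 3 ^ 3 * 5 ^ 1 \<and>
      180 \<notin> moduli C) \<and>
   (\<exists>C. distinct_covering_system C \<and> least_modulus C = 5 \<and>
      modulus_lcm C = 2 ^ 5 * 3 ^ 2 * 5 ^ 1)"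
  (is "?nonexistence \<and> ?ex5400 \<and> ?ex3600 \<and> ?ex2160 \<and> ?ex1440")
proof (intro conjI)
  show ?nonexistence
  proof (intro allI impI)
    fix C and a b c :: nat
    assume asm: "distinct_covering_system C \<and> least_modulus C = 5 \<and>
      modulus_lcm C = 2 ^ a * 3 ^ b * 5 ^ c \<and> 0 < a \<and> 0 < b \<and> 0 < c \<and> a \<ge> b \<and> b \<ge> c"
    then have dc: "distinct_covering_system C" and lm: "least_modulus C = 5"
      and lcm: "modulus_lcm C = 2 ^ a * 3 ^ b * 5 ^ c" by blast+
    have dvd: "modulus_lcm C dvd 2 ^ a * 3 ^ b' * 5 ^ c'" if "b \<le> b'" "c \<le> c'" for b' c'
      unfolding lcm using that by (intro mult_dvd_mono le_imp_power_dvd order_refl) auto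
    have "b \<ge> 2"
    proof (rule ccontr)
      assume "\<not> b \<ge> 2"
      then show False using no_covering_15[OF dc lm dvd] asm by simp
    qed
    \<comment> \<open>Enlarging the exponents only adds moduli, so it is enough to exclude the maximal cases.\<close>
    moreover have "b \<ge> 3 \<and> c \<ge> 2" if a: "a = 3"
    proof (rule ccontr)
      assume "\<not> (b \<ge> 3 \<and> c \<ge> 2)"
      then consider "b \<le> 2" "c \<le> 2" | "b \<le> 3" "c \<le> 1" using a asm by linarith
      then show False
      proof cases
        case 1
        show False
          by (rule no_covering[of 3 2 2, unfolded powers_eqs, OF check_1800 dc lm dvd[OF 1, unfolded a]])
      next
        case 2
        show False
          by (rule no_covering[of 3 3 1, unfolded powers_eqs, OF check_1080 dc lm dvd[OF 2, unfolded a]])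
      qed
    qed
    moreover have "c \<ge> 2" if ab: "a = 4" "b = 2"
    proof (rule ccontr)
      assume "\<not> c \<ge> 2"
      then have "b \<le> 2" "c \<le> 1" using ab by simp_all
      from dvd[OF this, unfolded ab(1)] show False
        by (rule no_covering[of 4 2 1, unfolded powers_eqs, OF check_720 dc lm])
    qed
    ultimately show "b \<ge> 2 \<and> (a = 3 \<longrightarrow> b \<ge> 3 \<and> c \<ge> 2) \<and> (a = 4 \<and> b = 2 \<longrightarrow> c \<ge> 2)" by blast
  qed
next
  note system = certified_imp_system[OF certified_system5400]
  \<comment> \<open>The modulus \<open>5400\<close> is a multiple of \<open>675\<close> and not available, but \<open>216\<close> and \<open>25\<close> are.\<close>
  have "modulus_lcm (system_of system5400) = 5400"
  proof (rule modulus_lcm_eqI)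
    show "modulus_lcm (system_of system5400) dvd 5400" using system(3) by simp
  next
    fix d assume "\<And>n. n \<in> moduli (system_of system5400) \<Longrightarrow> n dvd d"
    then have "216 dvd d" "25 dvd d" by (simp_all add: moduli_system_of system5400_def)
    moreover have "coprime 216 (25 :: nat)" by (simp add: coprime_iff_gcd_eq_1 gcd_non_0_nat)
    ultimately have "216 * 25 dvd d" by (intro divides_mult)
    then show "5400 dvd d" by simp
  qed
  moreover have "\<forall>n \<in> moduli (system_of system5400). \<not> 675 dvd n"
    by (simp add: moduli_system_of system5400_def)
  ultimately show ?ex5400 using system(1,2) by (intro exI[of _ "system_of system5400"]) simp
next
  note system = certified_imp_system[OF certified_system3600]
  have "modulus_lcm (system_of system3600) = 3600"
    by (rule modulus_lcm_eqI) (use system(3) in \<open>simp_all add: moduli_system_of system3600_def\<close>)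
  moreover have "{25, 100, 300, 900} \<inter> moduli (system_of system3600) = {}"
    by (simp add: moduli_system_of system3600_def)
  ultimately show ?ex3600 using system(1,2) by (intro exI[of _ "system_of system3600"]) simp
next
  note system = certified_imp_system[OF certified_system2160]
  have "modulus_lcm (system_of system2160) = 2160"
    by (rule modulus_lcm_eqI) (use system(3) in \<open>simp_all add: moduli_system_of system2160_def\<close>)
  moreover have "180 \<notin> moduli (system_of system2160)"
    by (simp add: moduli_system_of system2160_def)
  ultimately show ?ex2160 using system(1,2) by (intro exI[of _ "system_of system2160"]) simp
next
  note system = certified_imp_system[OF certified_system1440]
  have "modulus_lcm (system_of system1440) = 1440"
    by (rule modulus_lcm_eqI) (use system(3) in \<open>simp_all add: moduli_system_of system1440_def\<close>)
  then show ?ex1440 using system(1,2) by (intro exI[of _ "system_of system1440"]) simp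
qed

end
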